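(* For every $n\in\mathbb N$ there is a cyclically $5$-edge connected permutation snark $G$ of order $10+24n$. Moreover, $G$ has a permutation $2$-factor which is not contained in any circuit double cover of $G$.
   Context: A circuit is a $2$-regular $2$-connected graph. A circuit double cover (CDC) of a cubic graph $G$ is a set $S$ of circuits of $G$ such that every edge of $G$ is covered by exactly two circuits of $S$. A $2$-regular subgraph $D$ of $G$ is contained in $S$ if every circuit (component) of $D$ is an element of $S$. A cubic graph $G$ with a $2$-factor $F_2$ consisting of two chordless circuits is called a cycle permutation graph, and $F_2$ is called a permutation $2$-factor of $G$. A snark is (as usual) a cyclically $4$-edge connected cubic graph of girth at least $5$ that is not $3$-edge colorable. A permutation snark is a cycle permutation graph that is a snark. For a graph $G$ containing two vertex-disjoint circuits, the cyclic edge-connectivity $\lambda_c(G)$ is the minimum number of edges one needs to delete from $G$ in order to obtain two components each of which contains a circuit; $G$ is cyclically $k$-edge connected if $\lambda_c(G)\ge k$. The order of a graph is its number of vertices. *)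

theory Defs
  imports Main "HOL-Library.Extended_Nat"
begin

datatype 'a graph = Graph (verts: "'a set") (edges: "'a set set")

text \<open>All graphs are finite and simple; an edge is the set of its two end vertices.
  (For snarks, simplicity is forced by the girth condition.)\<close>

definition simple_graph :: "'a graph \<Rightarrow> bool" where
  "simple_graph G \<longleftrightarrow> finite (verts G) \<and> (\<forall>e\<in>edges G. e \<subseteq> verts G \<and> card e = 2)"

definition order :: "'a graph \<Rightarrow> nat" where
  "order G = card (verts G)"

definition subgraph :: "'a graph \<Rightarrow> 'a graph \<Rightarrow> bool" where
  "subgraph H G \<longleftrightarrow> simple_graph H \<and> verts H \<subseteq> verts G \<and> edges H \<subseteq> edges G"

definition degree :: "'a graph \<Rightarrow> 'a \<Rightarrow> nat" where
  "degree G v = card {e \<in> edges G. v \<in> e}"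

definition regular :: "nat \<Rightarrow> 'a graph \<Rightarrow> bool" where
  "regular k G \<longleftrightarrow> (\<forall>v\<in>verts G. degree G v = k)"

definition cubic :: "'a graph \<Rightarrow> bool" where
  "cubic G \<longleftrightarrow> simple_graph G \<and> regular 3 G"

definition connected :: "'a graph \<Rightarrow> bool" where
  "connected G \<longleftrightarrow> verts G \<noteq> {} \<and>
     (\<forall>u\<in>verts G. \<forall>v\<in>verts G. (u, v) \<in> {(x, y). {x, y} \<in> edges G}\<^sup>*)"

definition component :: "'a graph \<Rightarrow> 'a graph \<Rightarrow> bool" where
  "component H G \<longleftrightarrow> subgraph H G \<and> connected H \<and>
     (\<forall>K. subgraph K G \<and> connected K \<and> subgraph H K \<longrightarrow> K = H)"

definition delete_vertex :: "'a graph \<Rightarrow> 'a \<Rightarrow> 'a graph" where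
  "delete_vertex G v = Graph (verts G - {v}) {e \<in> edges G. v \<notin> e}"

definition delete_edges :: "'a graph \<Rightarrow> 'a set set \<Rightarrow> 'a graph" where
  "delete_edges G X = Graph (verts G) (edges G - X)"

definition two_connected :: "'a graph \<Rightarrow> bool" where
  "two_connected G \<longleftrightarrow> card (verts G) > 2 \<and> connected G \<and>
     (\<forall>v\<in>verts G. connected (delete_vertex G v))"

definition circuit :: "'a graph \<Rightarrow> bool" where
  "circuit C \<longleftrightarrow> simple_graph C \<and> regular 2 C \<and> two_connected C"

definition circuit_of :: "'a graph \<Rightarrow> 'a graph \<Rightarrow> bool" where
  "circuit_of C G \<longleftrightarrow> circuit C \<and> subgraph C G"

definition circuit_double_cover :: "'a graph set \<Rightarrow> 'a graph \<Rightarrow> bool" where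
  "circuit_double_cover S G \<longleftrightarrow> (\<forall>C\<in>S. circuit_of C G) \<and>
     (\<forall>e\<in>edges G. card {C \<in> S. e \<in> edges C} = 2)"

definition contained_in :: "'a graph \<Rightarrow> 'a graph set \<Rightarrow> bool" where
  "contained_in D S \<longleftrightarrow> (\<forall>C. component C D \<longrightarrow> C \<in> S)"

definition two_factor :: "'a graph \<Rightarrow> 'a graph \<Rightarrow> bool" where
  "two_factor F G \<longleftrightarrow> subgraph F G \<and> verts F = verts G \<and> regular 2 F"

definition chordless :: "'a graph \<Rightarrow> 'a graph \<Rightarrow> bool" where
  "chordless C G \<longleftrightarrow> (\<forall>e\<in>edges G. e \<subseteq> verts C \<longrightarrow> e \<in> edges C)"

definition permutation_two_factor :: "'a graph \<Rightarrow> 'a graph \<Rightarrow> bool" where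
  "permutation_two_factor F G \<longleftrightarrow> two_factor F G \<and> card {C. component C F} = 2 \<and>
     (\<forall>C. component C F \<longrightarrow> circuit C \<and> chordless C G)"

definition cycle_permutation_graph :: "'a graph \<Rightarrow> bool" where
  "cycle_permutation_graph G \<longleftrightarrow> cubic G \<and> (\<exists>F. permutation_two_factor F G)"

definition edge_colorable :: "nat \<Rightarrow> 'a graph \<Rightarrow> bool" where
  "edge_colorable k G \<longleftrightarrow> (\<exists>c :: 'a set \<Rightarrow> nat. (\<forall>e\<in>edges G. c e < k) \<and>
     (\<forall>e\<in>edges G. \<forall>f\<in>edges G. e \<noteq> f \<and> e \<inter> f \<noteq> {} \<longrightarrow> c e \<noteq> c f))"

text \<open>The girth of a graph without circuits is \<open>\<infinity>\<close>, the infimum of the empty set.\<close>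

definition girth :: "'a graph \<Rightarrow> enat" where
  "girth G = (INF C \<in> {C. circuit_of C G}. enat (card (edges C)))"

definition cyclic_edge_cut :: "'a graph \<Rightarrow> 'a set set \<Rightarrow> bool" where
  "cyclic_edge_cut G X \<longleftrightarrow> X \<subseteq> edges G \<and>
     (\<exists>H K. component H (delete_edges G X) \<and> component K (delete_edges G X) \<and> H \<noteq> K \<and>
        (\<exists>C. circuit_of C H) \<and> (\<exists>C. circuit_of C K))"

definition cyclic_edge_connectivity :: "'a graph \<Rightarrow> enat" where
  "cyclic_edge_connectivity G = (INF X \<in> {X. cyclic_edge_cut G X}. enat (card X))"

definition has_disjoint_circuits :: "'a graph \<Rightarrow> bool" where
  "has_disjoint_circuits G \<longleftrightarrow>
     (\<exists>C D. circuit_of C G \<and> circuit_of D G \<and> verts C \<inter> verts D = {})"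

text \<open>The cyclic edge-connectivity is only meaningful for graphs with two vertex-disjoint
  circuits; this is required explicitly, so that no graph is cyclically \<open>k\<close>-edge connected
  merely because it has no cyclic edge cut.\<close>

definition cyclically_edge_connected :: "nat \<Rightarrow> 'a graph \<Rightarrow> bool" where
  "cyclically_edge_connected k G \<longleftrightarrow>
     has_disjoint_circuits G \<and> cyclic_edge_connectivity G \<ge> enat k"

definition snark :: "'a graph \<Rightarrow> bool" where
  "snark G \<longleftrightarrow> cubic G \<and> cyclically_edge_connected 4 G \<and> girth G \<ge> 5 \<and> \<not> edge_colorable 3 G"

definition permutation_snark :: "'a graph \<Rightarrow> bool" where
  "permutation_snark G \<longleftrightarrow> cycle_permutation_graph G \<and> snark G"

end

(*
  In a permutation graph with rims R1 and R2 label every rim edge by the other circuit of a double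
  cover that contains it. If R1 and R2 belong to the cover, the two rim edges at a vertex get different
  labels, and these are the two circuits through the spoke; so both ends of a spoke see the same pair of
  labels. The colours of a 3-edge-colouring have this property as well. Hence one statement, the
  nonexistence of such a labelling, excludes both. Starting from the Petersen graph, twelve spokes are
  inserted repeatedly, and the relation between the labels on the boundary of the old part that the
  Petersen graph forces is reproduced by each insertion.

  A set of vertices spanning fewer than five cut edges but having at least three vertices inside and
  outside meets both rims in an arc, with the same spokes on both; so it suffices that the two cyclic
  orders of the spokes have no common nontrivial interval.
*)

theory Submission
  imports Defs "HOL-Library.Sublist"
begin

section \<open>Labellings along words\<close>

text \<open>The letters of a word are spokes, \<open>P\<close> gives the pair of labels seen by a spoke, and \<open>a\<close>, \<open>b\<close>
  are the labels of the rim edges before the first and after the last letter.\<close>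

fun chain :: "('a \<Rightarrow> 'l set) \<Rightarrow> 'a list \<Rightarrow> 'l \<Rightarrow> 'l \<Rightarrow> bool" where
  "chain P [] a b \<longleftrightarrow> a = b"
| "chain P (c # w) a b \<longleftrightarrow> (\<exists>d. a \<noteq> d \<and> P c = {a, d} \<and> chain P w d b)"

lemma chain_append: "chain P (u @ w) a b \<longleftrightarrow> (\<exists>d. chain P u a d \<and> chain P w d b)"
  by (induction u arbitrary: a) auto

text \<open>The spokes in their cyclic orders on the two rims are \<open>1 # 0 # outer n\<close> and \<open>1 # inner n\<close>; for \<open>n = 0\<close>
  this is the Petersen graph. Spoke \<open>0\<close> belongs to \<open>inner n\<close> only, which is why its labels take part
  in the boundary relation below.\<close>

fun outer :: "nat \<Rightarrow> nat list" and inner :: "nat \<Rightarrow> nat list" where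
  "outer 0 = [2, 3, 4]"
| "outer (Suc n) = (let k = 5 + 12 * n in
     [k, k+1, k+2, k+3] @ outer n @ [k+4, k+5, k+6, k+7, k+8, k+9, k+10, k+11])"
| "inner 0 = [3, 0, 4, 2]"
| "inner (Suc n) = (let k = 5 + 12 * n in
     [k+9] @ inner n @ [k+7, k+10, k+8, k+2, k, k+3, k+6, k+4, k+11, k+5, k+1])"

text \<open>These patterns were found by enumerating the labellings of the Petersen graph cut open at the
  spokes \<open>0\<close> and \<open>1\<close>; \<open>{p, q}\<close> are the labels at spoke \<open>0\<close>.\<close>

definition petersen_boundary :: "'l \<Rightarrow> 'l \<Rightarrow> 'l \<Rightarrow> 'l \<Rightarrow> 'l \<Rightarrow> 'l \<Rightarrow> bool" where
  "petersen_boundary x x' y y' p q \<longleftrightarrow>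
     x \<noteq> x' \<and> y = y' \<and> {p, q} = {x, x'} \<or>
     x = x' \<and> y \<noteq> y' \<and> x \<noteq> y \<and> x \<noteq> y' \<and> {p, q} = {y, y'} \<or>
     x \<noteq> x' \<and> y \<noteq> y' \<and> x' \<noteq> y' \<and> x = y \<and> {p, q} = {x', y'} \<or>
     x \<noteq> x' \<and> y \<noteq> y' \<and> x' \<noteq> y \<and> x = y' \<and> {p, q} = {x', y}"

text \<open>These are the labels along \<open>outer 0\<close> and \<open>inner 0\<close>: the three
  equations belong to the spokes 2, 3, 4, and \<open>y1\<close>, \<open>y2\<close> are the labels at
  spoke 0. Once equal pairs are rewritten as equations between elements, a problem in pure equality
  logic remains, whatever the type of labels.\<close>

lemma petersen_boundary_base:
  assumes "x0 \<noteq> x1" "x1 \<noteq> x2" "x2 \<noteq> x3" "y0 \<noteq> y1" "y1 \<noteq> y2" "y2 \<noteq> y3" "y3 \<noteq> y4"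
    and "{x0, x1} = {y3, y4}" "{x1, x2} = {y0, y1}" "{x2, x3} = {y2, y3}"
  shows "petersen_boundary x0 x3 y0 y4 y1 y2"
  using assms unfolding petersen_boundary_def doubleton_eq_iff
  by (smt (verit))

text \<open>\<open>x4\<close>, \<open>x5\<close> and \<open>y1\<close>, \<open>y2\<close> are the
  labels at the ends of the old words; the equations are those of the spokes \<open>k\<close> to
  \<open>k+11\<close>, in this order. Spoke 0 lies in the old part, so \<open>p\<close> and
  \<open>q\<close> are carried along.\<close>

lemma petersen_boundary_step:
  fixes s0 :: 'l
  assumes "petersen_boundary x4 x5 y1 y2 p q"
    and "x0 \<noteq> x1" "x1 \<noteq> x2" "x2 \<noteq> x3" "x3 \<noteq> x4"
     "x5 \<noteq> x6" "x6 \<noteq> x7" "x7 \<noteq> x8" "x8 \<noteq> x9" "x9 \<noteq> x10" "x10 \<noteq> x11" "x11 \<noteq> x12" "x12 \<noteq> x13"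
    and "y0 \<noteq> y1" "y2 \<noteq> y3" "y3 \<noteq> y4" "y4 \<noteq> y5" "y5 \<noteq> y6" "y6 \<noteq> y7" "y7 \<noteq> y8" "y8 \<noteq> y9" "y9 \<noteq> y10"
     "y10 \<noteq> y11" "y11 \<noteq> y12" "y12 \<noteq> y13"
    and "{x0, x1} = {y6, y7}" "{x1, x2} = {y12, y13}" "{x2, x3} = {y5, y6}" "{x3, x4} = {y7, y8}"
     "{x5, x6} = {y9, y10}" "{x6, x7} = {y11, y12}" "{x7, x8} = {y8, y9}" "{x8, x9} = {y2, y3}"
     "{x9, x10} = {y4, y5}" "{x10, x11} = {y0, y1}" "{x11, x12} = {y3, y4}" "{x12, x13} = {y10, y11}"
  shows "petersen_boundary x0 x13 y0 y13 p q"
  using assms unfolding petersen_boundary_def doubleton_eq_iff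
  by (smt (verit))

text \<open>The words stay open and their end labels are generalised in the induction, since each
  insertion contains the old words as contiguous blocks whose end labels are not fixed.\<close>

lemma chain_outer_inner:
  assumes "chain P (outer n) x x'" "chain P (inner n) y y'"
  obtains p q where "P 0 = {p, q}" "petersen_boundary x x' y y' p q"
  using assms
proof (induction n arbitrary: x x' y y' thesis)
  case 0
  obtain x1 x2 where x: "x \<noteq> x1" "P 2 = {x, x1}" "x1 \<noteq> x2" "P 3 = {x1, x2}" "x2 \<noteq> x'" "P 4 = {x2, x'}"
    using 0(2) by auto
  obtain y1 y2 y3 where y: "y \<noteq> y1" "P 3 = {y, y1}" "y1 \<noteq> y2" "P 0 = {y1, y2}" "y2 \<noteq> y3" "P 4 = {y2, y3}"
      "y3 \<noteq> y'" "P 2 = {y3, y'}"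
    using 0(3) by auto
  have "petersen_boundary x x' y y' y1 y2"
    by (rule petersen_boundary_base[of x x1 x2 x' y y1 y2 y3 y']) (use x y in auto)
  with y 0(1) show ?case by blast
next
  case (Suc n)
  define k where "k = 5 + 12 * n"
  obtain x4 x5 where x45: "chain P [k, k+1, k+2, k+3] x x4" "chain P (outer n) x4 x5"
      "chain P [k+4, k+5, k+6, k+7, k+8, k+9, k+10, k+11] x5 x'"
    using Suc.prems(2) unfolding outer.simps Let_def k_def[symmetric] chain_append by blast
  obtain y1 y2 where y12: "chain P [k+9] y y1" "chain P (inner n) y1 y2"
      "chain P [k+7, k+10, k+8, k+2, k, k+3, k+6, k+4, k+11, k+5, k+1] y2 y'"
    using Suc.prems(3) unfolding inner.simps Let_def k_def[symmetric] chain_append by blast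
  obtain x1 x2 x3 where x1: "P k = {x, x1}" "P (k+1) = {x1, x2}" "P (k+2) = {x2, x3}" "P (k+3) = {x3, x4}"
    "x \<noteq> x1" "x1 \<noteq> x2" "x2 \<noteq> x3" "x3 \<noteq> x4"
    using x45(1) by auto
  obtain x6 x7 x8 x9 x10 x11 x12 where x2:
    "P (k+4) = {x5, x6}" "P (k+5) = {x6, x7}" "P (k+6) = {x7, x8}" "P (k+7) = {x8, x9}"
    "P (k+8) = {x9, x10}" "P (k+9) = {x10, x11}" "P (k+10) = {x11, x12}" "P (k+11) = {x12, x'}"
    "x5 \<noteq> x6" "x6 \<noteq> x7" "x7 \<noteq> x8" "x8 \<noteq> x9" "x9 \<noteq> x10" "x10 \<noteq> x11" "x11 \<noteq> x12" "x12 \<noteq> x'"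
    using x45(3) by auto
  obtain y3 y4 y5 y6 y7 y8 y9 y10 y11 y12 where y2: "P (k+7) = {y2, y3}" "P (k+10) = {y3, y4}" "P (k+8) = {y4, y5}"
    "P (k+2) = {y5, y6}" "P k = {y6, y7}" "P (k+3) = {y7, y8}" "P (k+6) = {y8, y9}"
    "P (k+4) = {y9, y10}" "P (k+11) = {y10, y11}" "P (k+5) = {y11, y12}" "P (k+1) = {y12, y'}"
    "y2 \<noteq> y3" "y3 \<noteq> y4" "y4 \<noteq> y5" "y5 \<noteq> y6" "y6 \<noteq> y7" "y7 \<noteq> y8" "y8 \<noteq> y9"
    "y9 \<noteq> y10" "y10 \<noteq> y11" "y11 \<noteq> y12" "y12 \<noteq> y'"
    using y12(3) by auto
  have y1: "y \<noteq> y1" "P (k+9) = {y, y1}"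
    using y12(1) by auto
  obtain p q where pq: "P 0 = {p, q}" "petersen_boundary x4 x5 y1 y2 p q"
    using Suc.IH[OF _ x45(2) y12(2)] by blast
  have "petersen_boundary x x' y y' p q"
    by (rule petersen_boundary_step[OF pq(2) x1(5-8) x2(9-16) y1(1) y2(12-22)])
      (simp_all only: x1(1-4)[symmetric] x2(1-8)[symmetric] y1(2)[symmetric] y2(1-11)[symmetric])
  with pq(1) Suc.prems(1) show ?case by blast
qed

text \<open>Spoke 1 forces the end labels of \<open>inner n\<close> to differ and \<open>a\<close>,
  the last label of \<open>outer n\<close>, to be one of them. The first boundary pattern violates
  the former, each of the other three the latter.\<close>

lemma no_closed_chain_outer_inner:
  assumes "chain P (1 # 0 # outer n) a a" "chain P (1 # inner n) b b"
  shows False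
proof -
  obtain c x where cx: "a \<noteq> c" "P 1 = {a, c}" "c \<noteq> x" "P 0 = {c, x}" "chain P (outer n) x a"
    using assms(1) by auto
  obtain y where y: "b \<noteq> y" "P 1 = {b, y}" "chain P (inner n) y b"
    using assms(2) by auto
  obtain p q where "P 0 = {p, q}" "petersen_boundary x a y b p q"
    using chain_outer_inner[OF cx(5) y(3)] .
  with cx y show False unfolding petersen_boundary_def by (auto simp: doubleton_eq_iff)
qed

section \<open>Intervals of words\<close>

lemma subseq_set: "subseq v w \<Longrightarrow> x \<in> set v \<Longrightarrow> x \<in> set w"
  by (induction rule: list_emb.induct) auto

text \<open>The positions of the letters of \<open>w\<close> that lie in \<open>S\<close> form an initial segment, respectively an interval.\<close>

fun initial_in :: "'a set \<Rightarrow> 'a list \<Rightarrow> bool" where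
  "initial_in S [] \<longleftrightarrow> True"
| "initial_in S (x # w) \<longleftrightarrow> (if x \<in> S then initial_in S w else S \<inter> set w = {})"

fun convex_in :: "'a set \<Rightarrow> 'a list \<Rightarrow> bool" where
  "convex_in S [] \<longleftrightarrow> True"
| "convex_in S (x # w) \<longleftrightarrow> (if x \<in> S then initial_in S w else convex_in S w)"

lemma disjoint_imp_initial_in: "S \<inter> set w = {} \<Longrightarrow> initial_in S w"
  by (induction w) auto

lemma initial_in_imp_convex_in: "initial_in S w \<Longrightarrow> convex_in S w"
  by (induction w) (auto split: if_splits dest: disjoint_imp_initial_in)

lemma initial_in_subseq: "subseq v w \<Longrightarrow> initial_in S w \<Longrightarrow> initial_in S v"
proof (induction rule: list_emb.induct)
  case (list_emb_Cons xs ys y)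
  then show ?case by (auto split: if_splits dest: disjoint_imp_initial_in subseq_set intro!: disjoint_imp_initial_in)
next
  case (list_emb_Cons2 x y xs ys)
  then show ?case by (auto split: if_splits dest: subseq_set intro!: disjoint_imp_initial_in)
qed auto

text \<open>Deleting letters keeps an interval an interval. Hence the unknown old words can be
  replaced by one or two of their letters in the induction step.\<close>

lemma convex_in_subseq: "subseq v w \<Longrightarrow> convex_in S w \<Longrightarrow> convex_in S v"
proof (induction rule: list_emb.induct)
  case (list_emb_Cons xs ys y)
  then show ?case by (auto split: if_splits intro: initial_in_imp_convex_in)
next
  case (list_emb_Cons2 x y xs ys)
  then show ?case by (auto split: if_splits intro: initial_in_subseq)
qed auto


section \<open>Common intervals of the two words\<close>

lemma subseq_last: "b \<in> set B \<Longrightarrow> b \<noteq> last B \<Longrightarrow> subseq [b, last B] B"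
  by (induction B) (auto split: if_splits simp: subseq_singleton_left)

lemma subseq_hd: "b \<in> set B \<Longrightarrow> b \<noteq> hd B \<Longrightarrow> subseq [hd B, b] B"
  by (cases B) (auto simp: subseq_singleton_left)


lemma atLeastLessThan_12:
  "{k..<k+12} = {k, k+1, k+2, k+3, k+4, k+5, k+6, k+7, k+8, k+9, k+10, k+11::nat}"
  by (rule set_eqI, simp only: insert_iff empty_iff atLeastLessThan_iff, arith)

text \<open>If \<open>S\<close> contains all old letters, it swallows the new ones, which lie
  between letters already in \<open>S\<close>. If it contains exactly one, a letter outside
  \<open>S\<close> separates that one from each new letter. If it contains none, the orders of the
  new letters leave room for at most one of them.\<close>

lemma convex_in_step:
  fixes A B :: "nat list"
  assumes outer: "convex_in S ([0, k, k+1, k+2, k+3] @ A @ [k+4, k+5, k+6, k+7, k+8, k+9, k+10, k+11])"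
    and inner: "convex_in S ([k+9] @ B @ [k+7, k+10, k+8, k+2, k, k+3, k+6, k+4, k+11, k+5, k+1])"
    and IH: "set B \<subseteq> S \<or> (\<exists>c. S \<inter> set B \<subseteq> {c})"
    and B: "set B = insert 0 (set A)" and A: "A \<noteq> []"
    and neq: "hd B \<noteq> last A" "last B \<noteq> last A"
  shows "{k..<k+12} \<union> set B \<subseteq> S \<or> (\<exists>c. S \<inter> ({k..<k+12} \<union> set B) \<subseteq> {c})"
proof -
  have out: "convex_in S ([0, k, k+1, k+2, k+3] @ v @ [k+4, k+5, k+6, k+7, k+8, k+9, k+10, k+11])" if "subseq v A" for v
    by (rule convex_in_subseq[OF _ outer]) (intro list_emb_append_mono that subseq_order.refl)
  have inn: "convex_in S ([k+9] @ v @ [k+7, k+10, k+8, k+2, k, k+3, k+6, k+4, k+11, k+5, k+1])" if "subseq v B" for v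
    by (rule convex_in_subseq[OF _ inner]) (intro list_emb_append_mono that subseq_order.refl)
  have lastA: "last A \<in> set A" "last A \<in> set B"
    using A B by auto
  note outL = out[of "[last A]"] and inn0 = inn[of "[0]"]
  show ?thesis
  proof (cases "set B \<subseteq> S")
    case True
    then have "0 \<in> S" "last A \<in> S" using B lastA by auto
    then have "{k..<k+12} \<subseteq> S"
      using outL inn0 lastA B unfolding atLeastLessThan_12 by (auto simp: subseq_singleton_left split: if_splits)
    with True show ?thesis by simp
  next
    case False
    then obtain c where c: "S \<inter> set B \<subseteq> {c}" using IH by blast
    show ?thesis
    proof (cases "c \<in> S \<inter> set B")
      case True
      then have cS: "c \<in> S" "c \<in> set B" by auto
      have only: "b \<notin> S" if "b \<in> set B" "b \<noteq> c" for b
        using c that by auto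
      have "B \<noteq> []" using B by auto
      then have "hd B \<in> set B" "last B \<in> set B" by simp_all
      \<comment> \<open>On the outer word \<open>last A\<close> lies between \<open>c\<close> and
        these eight letters; \<open>0\<close> counts as an old letter in front.\<close>
      have right: "k+4 \<notin> S" "k+5 \<notin> S" "k+6 \<notin> S" "k+7 \<notin> S" "k+8 \<notin> S" "k+9 \<notin> S" "k+10 \<notin> S" "k+11 \<notin> S"
        if "c \<noteq> last A"
      proof -
        have "last A \<notin> S" using only lastA that by auto
        have "convex_in S [c, last A, k+4, k+5, k+6, k+7, k+8, k+9, k+10, k+11]"
        proof (cases "c = 0")
          case True
          show ?thesis unfolding True
            by (rule convex_in_subseq[OF _ outL]) (use lastA in \<open>simp_all add: subseq_singleton_left\<close>)
        next
          case False
          then have "subseq [c, last A] A" using cS(2) that subseq_last[of c A] unfolding B by blast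
          from out[OF this] show ?thesis by (rule convex_in_subseq[rotated]) simp
        qed
        then have "initial_in S [last A, k+4, k+5, k+6, k+7, k+8, k+9, k+10, k+11]"
          unfolding convex_in.simps(2)[of S c] using cS(1) by presburger
        with \<open>last A \<notin> S\<close>
        show "k+4 \<notin> S" "k+5 \<notin> S" "k+6 \<notin> S" "k+7 \<notin> S" "k+8 \<notin> S" "k+9 \<notin> S" "k+10 \<notin> S" "k+11 \<notin> S"
          by auto
      qed
      have "S \<inter> {k..<k+12} = {}"
      \<comment> \<open>If \<open>c\<close> is \<open>last A\<close>, it is at neither end of
        \<open>B\<close>: on the inner word \<open>hd B\<close> shields it from \<open>k+9\<close>
        and \<open>last B\<close> from the other eleven letters. Otherwise \<open>k+7\<close>,
        already known to be outside \<open>S\<close>, shields it from the letters that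
        follow.\<close>
      proof (cases "c = last A")
        case True
        then have ne: "c \<noteq> last B" "c \<noteq> hd B" using neq by auto
        then have "last B \<notin> S" "hd B \<notin> S" using only \<open>hd B \<in> set B\<close> \<open>last B \<in> set B\<close> by auto
        with inn[OF subseq_last[OF cS(2) ne(1)]] inn[OF subseq_hd[OF cS(2) ne(2)]] cS(1)
        show ?thesis unfolding atLeastLessThan_12 by (auto split: if_splits)
      next
        case False
        with right inn[of "[c]"] cS show ?thesis
          unfolding atLeastLessThan_12 by (auto simp: subseq_singleton_left split: if_splits)
      qed
      with c show ?thesis by (auto intro!: exI[of _ c])
    next
      case False
      with c have SB: "S \<inter> set B = {}" by auto
      then have n: "0 \<notin> S" "last A \<notin> S" using B lastA by auto
      \<comment> \<open>On the outer word \<open>last A\<close> confines the new letters in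
        \<open>S\<close> to \<open>k..k+3\<close> or to \<open>k+4..k+11\<close>, and on the inner
        word \<open>0\<close> splits off \<open>k+9\<close>. No two or more of the letters then form
        an interval in both words.\<close>
      have "\<exists>c. S \<inter> {k..<k+12} \<subseteq> {c}"
        using outL inn0 n lastA B unfolding atLeastLessThan_12
        by (auto simp: subseq_singleton_left split: if_splits)
      with SB show ?thesis by (simp add: Int_Un_distrib)
    qed
  qed
qed


lemma set_outer_Suc: "set (outer (Suc n)) = {5 + 12 * n..<5 + 12 * n + 12} \<union> set (outer n)"
  and set_inner_Suc: "set (inner (Suc n)) = {5 + 12 * n..<5 + 12 * n + 12} \<union> set (inner n)"
  unfolding atLeastLessThan_12 outer.simps inner.simps Let_def set_append list.set by blast+

lemma set_outer: "set (outer n) = {2..<5 + 12 * n}"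
  by (induction n) (simp, force, simp only: set_outer_Suc, force)

lemma set_inner: "set (inner n) = {..<5 + 12 * n} - {1}"
  by (induction n) (simp, force, simp only: set_inner_Suc, force)

lemma distinct_outer: "distinct (outer n)"
  by (induction n) (auto simp: Let_def set_outer)

lemma distinct_inner: "distinct (inner n)"
  by (induction n) (auto simp: Let_def set_inner)

lemma ends_outer_inner: "hd (inner n) \<noteq> last (outer n)" "last (inner n) \<noteq> last (outer n)"
proof -
  have "outer n \<noteq> []" "inner n \<noteq> []" for n by (cases n; simp add: Let_def)+
  then show "hd (inner n) \<noteq> last (outer n)" "last (inner n) \<noteq> last (outer n)"
    by (cases n; simp add: Let_def)+
qed

text \<open>Cutting both cyclic orders open at spoke 1 turns the arcs that avoid it into intervals
  of these two words.\<close>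

lemma convex_in_outer_inner:
  assumes "convex_in S (0 # outer n)" "convex_in S (inner n)"
  shows "set (inner n) \<subseteq> S \<or> (\<exists>c. S \<inter> set (inner n) \<subseteq> {c})"
  using assms
proof (induction n)
  case 0
  then show ?case by (auto split: if_splits)
next
  case (Suc n)
  define k where "k = 5 + 12 * n"
  have out: "convex_in S ([0, k, k+1, k+2, k+3] @ outer n @ [k+4, k+5, k+6, k+7, k+8, k+9, k+10, k+11])"
    using Suc.prems(1) unfolding outer.simps Let_def k_def[symmetric] append_Cons append_Nil .
  have inn: "convex_in S ([k+9] @ inner n @ [k+7, k+10, k+8, k+2, k, k+3, k+6, k+4, k+11, k+5, k+1])"
    using Suc.prems(2) unfolding inner.simps Let_def k_def[symmetric] append_Cons append_Nil .
  have "subseq ([0] @ outer n) ([0, k, k+1, k+2, k+3] @ outer n @ [k+4, k+5, k+6, k+7, k+8, k+9, k+10, k+11])"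
    by (rule list_emb_append_mono[of _ "[0]" "[0, k, k+1, k+2, k+3]"]) (auto intro: list_emb_append2)
  from convex_in_subseq[OF this out] have "convex_in S (0 # outer n)" by simp
  moreover have "subseq (inner n) ([k+9] @ inner n @ [k+7, k+10, k+8, k+2, k, k+3, k+6, k+4, k+11, k+5, k+1])"
    by (rule list_emb_append2, rule list_emb_append_mono[of _ _ _ "[]", simplified append_Nil2]) auto
  from convex_in_subseq[OF this inn] have "convex_in S (inner n)" .
  ultimately have IH: "set (inner n) \<subseteq> S \<or> (\<exists>c. S \<inter> set (inner n) \<subseteq> {c})"
    by (rule Suc.IH)
  have "set (inner n) = insert 0 (set (outer n))"
    unfolding set_inner set_outer by auto
  moreover have "outer n \<noteq> []" by (cases n) (simp_all add: Let_def)
  ultimately have "{k..<k+12} \<union> set (inner n) \<subseteq> S \<or> (\<exists>c. S \<inter> ({k..<k+12} \<union> set (inner n)) \<subseteq> {c})"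
    by (rule convex_in_step[OF out inn IH _ _ ends_outer_inner])
  then show ?case unfolding set_inner_Suc k_def[symmetric] .
qed

section \<open>Cycles\<close>

definition cycle_edge :: "'a list \<Rightarrow> nat \<Rightarrow> 'a set" where
  "cycle_edge w i = {w ! i, w ! (Suc i mod length w)}"

definition cycle_graph :: "'a list \<Rightarrow> 'a graph" where
  "cycle_graph w = Graph (set w) (cycle_edge w ` {..<length w})"

lemma verts_cycle_graph [simp]: "verts (cycle_graph w) = set w"
  and edges_cycle_graph: "edges (cycle_graph w) = cycle_edge w ` {..<length w}"
  by (simp_all add: cycle_graph_def)

lemma Suc_mod_eq: "i < m \<Longrightarrow> Suc i mod m = (if Suc i = m then 0 else Suc i)"
  by (auto simp: mod_Suc)

lemma mod_add_neq:
  fixes i d m :: nat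
  assumes "i < m" "0 < d" "d < m"
  shows "(i + d) mod m \<noteq> i"
  using assms by (cases "i + d < m") (simp_all add: le_mod_geq)

context
  fixes w :: "'a list"
  assumes w: "distinct w" "3 \<le> length w"
begin

text \<open>Two positions with the same edge would be each other's successor, which is impossible
  for length at least 3.\<close>

lemma inj_on_cycle_edge: "inj_on (cycle_edge w) {..<length w}"
proof (rule inj_onI)
  fix i j assume ij: "i \<in> {..<length w}" "j \<in> {..<length w}" "cycle_edge w i = cycle_edge w j"
  have "Suc i mod length w < length w" "Suc j mod length w < length w"
    using w by (auto intro: mod_less_divisor)
  with ij w have "i = j \<or> i = Suc j mod length w \<and> Suc i mod length w = j"
    by (auto simp: cycle_edge_def doubleton_eq_iff nth_eq_iff_index_eq)
  then show "i = j"
    using ij w by (auto simp: Suc_mod_eq split: if_splits)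
qed

lemma in_cycle_edge_iff:
  assumes "i < length w" "j < length w"
  shows "w ! i \<in> cycle_edge w j \<longleftrightarrow> j = i \<or> Suc j mod length w = i"
proof -
  have "Suc j mod length w < length w"
    using w by (auto intro: mod_less_divisor)
  with assms w show ?thesis by (auto simp: cycle_edge_def nth_eq_iff_index_eq)
qed

text \<open>The index \<open>(i + length w - 1) mod length w\<close> is the predecessor of
  \<open>i\<close>; adding the length first avoids truncated subtraction at
  \<open>i = 0\<close>.\<close>

lemma edges_at_cycle_graph:
  assumes "i < length w"
  shows "{e \<in> edges (cycle_graph w). w ! i \<in> e} = {cycle_edge w ((i + length w - 1) mod length w), cycle_edge w i}"
    and "(i + length w - 1) mod length w < length w" "(i + length w - 1) mod length w \<noteq> i"
proof -
  let ?j = "(i + length w - 1) mod length w"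
  have j: "?j = (if i = 0 then length w - 1 else i - 1)"
    using assms w by (cases i) auto
  then show "?j < length w" "?j \<noteq> i"
    using assms w by (auto split: if_splits)
  have "w ! i \<in> cycle_edge w j \<longleftrightarrow> j = i \<or> j = ?j" if "j < length w" for j
    unfolding in_cycle_edge_iff[OF assms that] j
    using that assms w by (auto simp: Suc_mod_eq split: if_splits)
  then show "{e \<in> edges (cycle_graph w). w ! i \<in> e} = {cycle_edge w ?j, cycle_edge w i}"
    using \<open>?j < length w\<close> assms unfolding edges_cycle_graph by blast
qed

lemma degree_cycle_graph: "v \<in> set w \<Longrightarrow> degree (cycle_graph w) v = 2"
proof -
  assume "v \<in> set w"
  then obtain i where i: "i < length w" "v = w ! i" by (auto simp: in_set_conv_nth)
  note e = edges_at_cycle_graph[OF i(1)]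
  have "cycle_edge w ((i + length w - 1) mod length w) \<noteq> cycle_edge w i"
    using inj_onD[OF inj_on_cycle_edge] e(2,3) i(1) by blast
  then show ?thesis unfolding degree_def i(2) e(1) by simp
qed

lemma simple_cycle_graph: "simple_graph (cycle_graph w)"
proof -
  have "cycle_edge w i \<subseteq> set w" "card (cycle_edge w i) = 2" if "i < length w" for i
  proof -
    have "Suc i mod length w < length w" "Suc i mod length w \<noteq> i"
      using w that by (auto simp: Suc_mod_eq)
    then show "cycle_edge w i \<subseteq> set w" "card (cycle_edge w i) = 2"
      using that w by (auto simp: cycle_edge_def nth_eq_iff_index_eq card_insert_if)
  qed
  then show ?thesis by (auto simp: simple_graph_def edges_cycle_graph)
qed

end

section \<open>Connectivity of cycles\<close>

definition adj :: "'a graph \<Rightarrow> ('a \<times> 'a) set" where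
  "adj G = {(x, y). {x, y} \<in> edges G}"

lemma connected_iff:
  "connected G \<longleftrightarrow> verts G \<noteq> {} \<and> (\<forall>u\<in>verts G. \<forall>v\<in>verts G. (u, v) \<in> (adj G)\<^sup>*)"
  by (simp add: connected_def adj_def)

lemma sym_rtrancl_adj: "sym ((adj G)\<^sup>*)"
  by (intro sym_rtrancl symI) (auto simp: adj_def insert_commute)

lemma connectedI:
  assumes "c \<in> verts G" "\<And>v. v \<in> verts G \<Longrightarrow> (c, v) \<in> (adj G)\<^sup>*"
  shows "connected G"
  using assms symD[OF sym_rtrancl_adj[of G]] unfolding connected_iff by (blast intro: rtrancl_trans)

context
  fixes w :: "'a list"
  assumes w: "distinct w" "3 \<le> length w"
begin

lemma rtrancl_path_cycle_graph:
  assumes "i < length w" "j < length w - 1"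
  shows "(w ! ((i + 1) mod length w), w ! ((i + 1 + j) mod length w)) \<in> (adj (delete_vertex (cycle_graph w) (w ! i)))\<^sup>*"
  using assms(2)
proof (induction j)
  case (Suc j)
  let ?k = "(i + 1 + j) mod length w"
  have k: "?k < length w" "Suc ?k mod length w = (i + 1 + Suc j) mod length w"
    using w by (auto simp: mod_Suc_eq intro: mod_less_divisor)
  have ne: "?k \<noteq> i" "Suc ?k mod length w \<noteq> i"
  proof -
    have "(i + (1 + j)) mod length w \<noteq> i" "(i + (1 + Suc j)) mod length w \<noteq> i"
      by (rule mod_add_neq; use assms(1) Suc.prems in linarith)+
    then show "?k \<noteq> i" "Suc ?k mod length w \<noteq> i"
      unfolding k(2) by (simp_all only: add.assoc not_False_eq_True)
  qed
  have "w ! i \<notin> cycle_edge w ?k"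
    using in_cycle_edge_iff[OF w assms(1) k(1)] ne by simp
  then have "(w ! ?k, w ! ((i + 1 + Suc j) mod length w)) \<in> adj (delete_vertex (cycle_graph w) (w ! i))"
    using k unfolding adj_def delete_vertex_def edges_cycle_graph by (auto simp: cycle_edge_def image_iff)
  with Suc show ?case by (auto intro: rtrancl_into_rtrancl)
qed simp

lemma connected_delete_vertex_cycle_graph:
  assumes "v \<in> set w"
  shows "connected (delete_vertex (cycle_graph w) v)"
proof -
  obtain i where i: "i < length w" "v = w ! i"
    using assms by (auto simp: in_set_conv_nth)
  show ?thesis
  proof (rule connectedI)
    have "(i + 1) mod length w < length w" "(i + 1) mod length w \<noteq> i"
      using i(1) w by (auto simp: Suc_mod_eq)
    then show "w ! ((i + 1) mod length w) \<in> verts (delete_vertex (cycle_graph w) v)"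
      using i w by (simp add: delete_vertex_def nth_eq_iff_index_eq)
    fix x assume "x \<in> verts (delete_vertex (cycle_graph w) v)"
    then obtain l where l: "l < length w" "x = w ! l" "l \<noteq> i"
      using i by (auto simp: delete_vertex_def in_set_conv_nth)
    \<comment> \<open>The number of steps from the successor of \<open>i\<close> to
      \<open>l\<close>; for \<open>l < i\<close> the walk passes the end of the word.\<close>
    define j where "j = (if l > i then l - i - 1 else l + length w - i - 1)"
    have "j < length w - 1" using l i by (auto simp: j_def)
    have "i + 1 + j = (if l > i then l else l + length w)" using l i by (auto simp: j_def)
    then have "(i + 1 + j) mod length w = l" using l by simp
    with rtrancl_path_cycle_graph[OF i(1) \<open>j < length w - 1\<close>] show "(w ! ((i + 1) mod length w), x) \<in> (adj (delete_vertex (cycle_graph w) v))\<^sup>*"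
      using l i by simp
  qed
qed

lemma connected_cycle_graph: "connected (cycle_graph w)"
proof (rule connectedI)
  show "w ! 0 \<in> verts (cycle_graph w)" using w by (cases w) auto
  fix v assume "v \<in> verts (cycle_graph w)"
  then obtain i where i: "i < length w" "v = w ! i"
    by (auto simp: in_set_conv_nth)
  have "i < length w \<longrightarrow> (w ! 0, w ! i) \<in> (adj (cycle_graph w))\<^sup>*"
  proof (induction i)
    case (Suc i)
    have "(w ! i, w ! Suc i) \<in> adj (cycle_graph w)" if "Suc i < length w"
      using that by (auto simp: adj_def edges_cycle_graph cycle_edge_def image_iff intro!: bexI[of _ i])
    with Suc show ?case by (auto intro: rtrancl_into_rtrancl)
  qed simp
  with i show "(w ! 0, v) \<in> (adj (cycle_graph w))\<^sup>*" by simp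
qed

lemma circuit_cycle_graph: "circuit (cycle_graph w)"
  using w simple_cycle_graph[OF w] degree_cycle_graph[OF w]
    connected_cycle_graph connected_delete_vertex_cycle_graph
  by (auto simp: circuit_def two_connected_def regular_def distinct_card)

end

section \<open>Components and cyclic cuts\<close>

lemma rtrancl_adj_mono: "edges H \<subseteq> edges G \<Longrightarrow> (x, y) \<in> (adj H)\<^sup>* \<Longrightarrow> (x, y) \<in> (adj G)\<^sup>*"
  by (rule rtrancl_mono[THEN subsetD]) (auto simp: adj_def)

definition graph_union :: "'a graph \<Rightarrow> 'a graph \<Rightarrow> 'a graph" where
  "graph_union H K = Graph (verts H \<union> verts K) (edges H \<union> edges K)"

lemma graph_union_sel [simp]:
  "verts (graph_union H K) = verts H \<union> verts K" "edges (graph_union H K) = edges H \<union> edges K"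
  by (simp_all add: graph_union_def)

lemma connected_graph_union:
  assumes "connected H" "connected K" "v \<in> verts H" "v \<in> verts K"
  shows "connected (graph_union H K)"
proof (rule connectedI)
  show "v \<in> verts (graph_union H K)" using assms by simp
  fix x assume "x \<in> verts (graph_union H K)"
  then have "(v, x) \<in> (adj H)\<^sup>* \<or> (v, x) \<in> (adj K)\<^sup>*"
    using assms by (auto simp: connected_iff)
  then show "(v, x) \<in> (adj (graph_union H K))\<^sup>*"
    using rtrancl_adj_mono[of H "graph_union H K"] rtrancl_adj_mono[of K "graph_union H K"] by auto
qed

lemma subgraph_graph_union:
  "subgraph H G \<Longrightarrow> subgraph K G \<Longrightarrow> subgraph (graph_union H K) G"
  by (auto simp: subgraph_def simple_graph_def)

text \<open>The union of \<open>H\<close> and \<open>K\<close> is connected through \<open>v\<close>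
  and extends \<open>H\<close>, so the maximality of \<open>H\<close> makes it equal to
  \<open>H\<close>.\<close>

lemma component_absorbs:
  assumes "component H G" "subgraph K G" "connected K" "v \<in> verts H" "v \<in> verts K"
  shows "subgraph K H"
proof -
  have "subgraph H G" "connected H" using assms(1) by (auto simp: component_def)
  then have "graph_union H K = H"
    using assms connected_graph_union[of H K v] subgraph_graph_union[of H G K]
    unfolding component_def by (metis graph_union_sel subgraph_def sup_ge1)
  then have "verts K \<subseteq> verts H" "edges K \<subseteq> edges H"
    by (metis graph_union_sel(1) sup_ge2) (metis \<open>graph_union H K = H\<close> graph_union_sel(2) sup_ge2)
  then show ?thesis using assms(2) by (auto simp: subgraph_def)
qed

lemma subgraph_antisym: "subgraph H K \<Longrightarrow> subgraph K H \<Longrightarrow> H = K"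
  by (cases H; cases K) (auto simp: subgraph_def)

lemma components_disjoint:
  assumes "component H G" "component K G" "H \<noteq> K"
  shows "verts H \<inter> verts K = {}"
proof (rule ccontr)
  assume "verts H \<inter> verts K \<noteq> {}"
  then obtain v where "v \<in> verts H" "v \<in> verts K" by auto
  then have "subgraph K H" "subgraph H K"
    using assms component_absorbs[of H G K v] component_absorbs[of K G H v]
    by (auto simp: component_def)
  with assms(3) subgraph_antisym show False by blast
qed

text \<open>A single edge with its ends is a connected subgraph, so the component absorbs
  it.\<close>

lemma component_closed:
  assumes "component H G" "simple_graph G" "e \<in> edges G" "x \<in> e" "x \<in> verts H"
  shows "e \<subseteq> verts H"
proof -
  obtain y where y: "e = {x, y}" "x \<noteq> y"
    using assms(2-4) by (fastforce simp: simple_graph_def card_2_iff)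
  let ?K = "Graph e {e}"
  have "connected ?K"
    by (rule connectedI[of x]) (use y in \<open>auto simp: adj_def\<close>)
  moreover have "subgraph ?K G"
    using assms(2,3) y by (auto simp: subgraph_def simple_graph_def)
  ultimately have "subgraph ?K H"
    using component_absorbs[OF assms(1)] assms(4,5) by auto
  then show ?thesis by (auto simp: subgraph_def)
qed

lemma connected_in_part:
  assumes "connected C" "v \<in> verts C" "v \<in> A" "\<And>e. e \<in> edges C \<Longrightarrow> e \<inter> A \<noteq> {} \<Longrightarrow> e \<subseteq> A"
  shows "verts C \<subseteq> A"
proof
  fix x assume "x \<in> verts C"
  then have "(v, x) \<in> (adj C)\<^sup>*" using assms by (auto simp: connected_iff)
  then show "x \<in> A"
    by (induction rule: rtrancl_induct) (use assms(3,4) in \<open>auto simp: adj_def\<close>)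
qed

text \<open>No edge of the union joins the two vertex sets, so a connected subgraph extending
  \<open>H\<close> cannot leave \<open>verts H\<close>.\<close>

lemma component_graph_union_left:
  assumes "simple_graph H" "connected H" "simple_graph K" "verts H \<inter> verts K = {}"
  shows "component H (graph_union H K)"
  unfolding component_def
proof (intro conjI allI impI)
  show "subgraph H (graph_union H K)" using assms(1) by (auto simp: subgraph_def)
  fix C assume C: "subgraph C (graph_union H K) \<and> connected C \<and> subgraph H C"
  obtain v where v: "v \<in> verts H" using assms(2) by (auto simp: connected_iff)
  have side: "e \<in> edges H \<and> e \<subseteq> verts H \<or> e \<subseteq> verts K" "e \<noteq> {}" if "e \<in> edges C" for e
  proof -
    have "e \<in> edges H \<or> e \<in> edges K" "card e = 2" using C that by (auto simp: subgraph_def simple_graph_def)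
    then show "e \<in> edges H \<and> e \<subseteq> verts H \<or> e \<subseteq> verts K" "e \<noteq> {}"
      using assms(1,3) by (auto simp: simple_graph_def)
  qed
  have VC: "verts C \<subseteq> verts H"
  proof (rule connected_in_part[of C v])
    show "v \<in> verts C" "connected C" using C v by (auto simp: subgraph_def)
    show "e \<subseteq> verts H" if "e \<in> edges C" "e \<inter> verts H \<noteq> {}" for e
      using side(1)[OF that(1)] that(2) assms(4) by blast
  qed (rule v)
  moreover have "e \<in> edges H" if "e \<in> edges C" for e
  proof -
    have "e \<subseteq> verts H" using that C VC by (auto simp: subgraph_def simple_graph_def)
    with side[OF that] assms(4) show ?thesis by blast
  qed
  ultimately have "subgraph C H" using C by (auto simp: subgraph_def)
  with C subgraph_antisym show "C = H" by blast
qed (use assms in auto)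

lemma graph_union_commute: "graph_union H K = graph_union K H"
  by (simp add: graph_union_def Un_commute)

lemma component_graph_union_iff:
  assumes "simple_graph H" "connected H" "simple_graph K" "connected K" "verts H \<inter> verts K = {}"
  shows "component C (graph_union H K) \<longleftrightarrow> C = H \<or> C = K"
proof
  have HK: "component H (graph_union H K)" "component K (graph_union H K)"
    using component_graph_union_left[of H K] component_graph_union_left[of K H] assms
    by (auto simp: graph_union_commute Int_commute)
  then show "component C (graph_union H K)" if "C = H \<or> C = K"
    using that by auto
  assume C: "component C (graph_union H K)"
  then obtain v where "v \<in> verts C" "v \<in> verts H \<union> verts K"
    by (auto simp: component_def connected_iff subgraph_def)
  with components_disjoint[OF C HK(1)] components_disjoint[OF C HK(2)] show "C = H \<or> C = K"
    by auto
qed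

section \<open>Edge cuts, cyclic connectivity and girth\<close>

definition cut :: "'a graph \<Rightarrow> 'a set \<Rightarrow> 'a set set" where
  "cut G W = {e \<in> edges G. e \<inter> W \<noteq> {} \<and> \<not> e \<subseteq> W}"

lemma simple_finite_edges: "simple_graph G \<Longrightarrow> finite (edges G)"
  unfolding simple_graph_def by (rule finite_subset[of _ "Pow (verts G)"]) auto

lemma circuit_card_verts: "circuit C \<Longrightarrow> 3 \<le> card (verts C)"
  by (simp add: circuit_def two_connected_def)

text \<open>Deleting a cyclic edge cut \<open>X\<close> leaves a component \<open>H\<close> with a
  circuit and another circuit outside \<open>H\<close>, each with at least three vertices. Every
  edge leaving \<open>verts H\<close> lies in \<open>X\<close>, so a bound on vertex cuts bounds
  \<open>X\<close>.\<close>

lemma cyclically_edge_connectedI: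
  assumes "simple_graph G" "has_disjoint_circuits G"
    and "\<And>W. W \<subseteq> verts G \<Longrightarrow> 3 \<le> card W \<Longrightarrow> 3 \<le> card (verts G - W) \<Longrightarrow> k \<le> card (cut G W)"
  shows "cyclically_edge_connected k G"
  unfolding cyclically_edge_connected_def cyclic_edge_connectivity_def
proof (intro conjI INF_greatest assms(2))
  fix X assume "X \<in> {X. cyclic_edge_cut G X}"
  then obtain H K C D where X: "X \<subseteq> edges G"
    and H: "component H (delete_edges G X)" and K: "component K (delete_edges G X)" "H \<noteq> K"
    and CD: "circuit_of C H" "circuit_of D K"
    by (auto simp: cyclic_edge_cut_def)
  have simple: "simple_graph (delete_edges G X)" and fin: "finite (verts G)"
    using assms(1) by (auto simp: delete_edges_def simple_graph_def)
  have sub: "verts H \<subseteq> verts G" "verts K \<subseteq> verts G - verts H"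
    using H K components_disjoint[OF H K] by (auto simp: component_def subgraph_def delete_edges_def)
  have "verts C \<subseteq> verts H" "verts D \<subseteq> verts G - verts H"
    using CD sub by (auto simp: circuit_of_def subgraph_def)
  then have "card (verts C) \<le> card (verts H)" "card (verts D) \<le> card (verts G - verts H)"
    using fin sub by (auto intro: card_mono finite_subset)
  moreover have "3 \<le> card (verts C)" "3 \<le> card (verts D)"
    using CD by (auto simp: circuit_of_def circuit_card_verts)
  ultimately have "k \<le> card (cut G (verts H))"
    using assms(3) sub by auto
  also have "cut G (verts H) \<subseteq> X"
    using component_closed[OF H simple] by (auto simp: cut_def delete_edges_def)
  then have "card (cut G (verts H)) \<le> card X"
    using X simple_finite_edges[OF assms(1)] by (auto intro: card_mono finite_subset)
  finally show "enat k \<le> enat (card X)" by simp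
qed

lemma handshake:
  assumes "simple_graph C"
  shows "(\<Sum>v\<in>verts C. degree C v) = 2 * card (edges C)"
proof -
  have fin: "finite (verts C)" "finite (edges C)"
    using assms simple_finite_edges by (auto simp: simple_graph_def)
  have "(\<Sum>v\<in>verts C. degree C v) = (\<Sum>v\<in>verts C. \<Sum>e\<in>{e\<in>edges C. v \<in> e}. 1)"
    by (simp add: degree_def)
  also have "\<dots> = (\<Sum>e\<in>edges C. \<Sum>v\<in>{v\<in>verts C. v \<in> e}. 1)"
    by (rule sum.swap_restrict[OF fin])
  also have "\<dots> = (\<Sum>e\<in>edges C. 2)"
  proof (rule sum.cong)
    fix e assume "e \<in> edges C"
    then have "{v\<in>verts C. v \<in> e} = e" "card e = 2"
      using assms by (auto simp: simple_graph_def)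
    then show "(\<Sum>v\<in>{v\<in>verts C. v \<in> e}. 1) = (2::nat)" by simp
  qed simp
  finally show ?thesis by simp
qed

text \<open>A circuit with at most four edges has equally many vertices, and in a cubic graph each
  of them has one further edge. So at most four edges would separate these vertices from the at
  least six others.\<close>

lemma girth_ge5I:
  assumes "cubic G" "10 \<le> card (verts G)"
    and cut: "\<And>W. W \<subseteq> verts G \<Longrightarrow> 3 \<le> card W \<Longrightarrow> 3 \<le> card (verts G - W) \<Longrightarrow> 5 \<le> card (cut G W)"
  shows "girth G \<ge> 5"
proof -
  have "5 \<le> card (edges C)" if "circuit_of C G" for C
  proof (rule ccontr)
    assume less: "\<not> 5 \<le> card (edges C)"
    have C: "simple_graph C" "\<And>v. v \<in> verts C \<Longrightarrow> degree C v = 2" "verts C \<subseteq> verts G" "edges C \<subseteq> edges G"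
      and C3: "3 \<le> card (verts C)"
      using that by (auto simp: circuit_of_def circuit_def regular_def subgraph_def two_connected_def)
    have G: "simple_graph G" "\<And>v. v \<in> verts G \<Longrightarrow> degree G v = 3"
      using assms(1) by (auto simp: cubic_def regular_def)
    have fin: "finite (edges G)" "finite (verts G)" "finite (verts C)" "finite (edges C)"
      using simple_finite_edges[OF G(1)] simple_finite_edges[OF C(1)] G(1) C(1) by (auto simp: simple_graph_def)
    have "card (verts C) = card (edges C)"
      using handshake[OF C(1)] C(2) by simp
    then have small: "card (verts C) \<le> 4" using less by simp
    have "3 \<le> card (verts G - verts C)"
      using assms(2) small C(3) fin by (simp add: card_Diff_subset)
    then have "5 \<le> card (cut G (verts C))"
      using cut C(3) C3 by blast
    also have "cut G (verts C) \<subseteq> (\<Union>v\<in>verts C. {e\<in>edges G. v \<in> e} - {e\<in>edges C. v \<in> e})"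
      using C(1) by (auto simp: cut_def simple_graph_def)
    then have "card (cut G (verts C)) \<le> card (\<Union>v\<in>verts C. {e\<in>edges G. v \<in> e} - {e\<in>edges C. v \<in> e})"
      by (rule card_mono[rotated]) (use fin in auto)
    also have "\<dots> \<le> (\<Sum>v\<in>verts C. card ({e\<in>edges G. v \<in> e} - {e\<in>edges C. v \<in> e}))"
      by (rule card_UN_le[OF fin(3)])
    also have "\<dots> = (\<Sum>v\<in>verts C. 1)"
    proof (rule sum.cong)
      fix v assume v: "v \<in> verts C"
      have "card ({e\<in>edges G. v \<in> e} - {e\<in>edges C. v \<in> e}) = degree G v - degree C v"
        unfolding degree_def by (rule card_Diff_subset) (use C(4) fin in auto)
      then show "card ({e\<in>edges G. v \<in> e} - {e\<in>edges C. v \<in> e}) = 1"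
        using C(2,3) G(2) v by auto
    qed simp
    finally show False using small by simp
  qed
  then have "enat 5 \<le> girth G"
    unfolding girth_def by (intro INF_greatest) auto
  then show ?thesis by (simp add: numeral_eq_enat)
qed

section \<open>Labellings and cuts of cycles\<close>

lemma chain_map: "chain P (map f w) a b \<longleftrightarrow> chain (P \<circ> f) w a b"
  by (induction w arbitrary: a) auto

lemma chain_nth:
  assumes "\<And>i. i < length w \<Longrightarrow> x i \<noteq> x (Suc i) \<and> P (w ! i) = {x i, x (Suc i)}"
  shows "chain P w (x 0) (x (length w))"
  using assms
proof (induction w arbitrary: x)
  case (Cons c w)
  have "chain P w (x (Suc 0)) (x (Suc (length w)))"
    using Cons.IH[of "\<lambda>i. x (Suc i)"] Cons.prems[of "Suc _"] by simp
  with Cons.prems[of 0] show ?case by auto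
qed simp

text \<open>The labels of successive edges serve as the intermediate labels of the chain, beginning
  with the edge that enters position 0.\<close>

lemma cycle_graph_labelling_chain:
  assumes w: "distinct w" "3 \<le> length w"
    and lab: "\<And>v e f. v \<in> e \<Longrightarrow> v \<in> f \<Longrightarrow> e \<in> edges (cycle_graph w) \<Longrightarrow> f \<in> edges (cycle_graph w) \<Longrightarrow> e \<noteq> f \<Longrightarrow>
      lab e \<noteq> lab f \<and> P v = {lab e, lab f}"
  shows "\<exists>a. chain P w a a"
proof -
  let ?m = "length w"
  let ?x = "\<lambda>i. lab (cycle_edge w ((i + ?m - 1) mod ?m))"
  have "?x i \<noteq> ?x (Suc i) \<and> P (w ! i) = {?x i, ?x (Suc i)}" if i: "i < ?m" for i
  proof -
    let ?j = "(i + ?m - 1) mod ?m"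
    note e = edges_at_cycle_graph[OF w i]
    have "cycle_edge w ?j \<noteq> cycle_edge w i"
      using inj_onD[OF inj_on_cycle_edge[OF w]] e(2,3) i by blast
    moreover have "w ! i \<in> cycle_edge w ?j" "w ! i \<in> cycle_edge w i"
       "cycle_edge w ?j \<in> edges (cycle_graph w)" "cycle_edge w i \<in> edges (cycle_graph w)"
      using e(1) by blast+
    ultimately have "lab (cycle_edge w ?j) \<noteq> lab (cycle_edge w i) \<and>
        P (w ! i) = {lab (cycle_edge w ?j), lab (cycle_edge w i)}"
      using lab by blast
    then show ?thesis using i by simp
  qed
  then have "chain P w (?x 0) (?x ?m)" by (rule chain_nth)
  \<comment> \<open>A full turn returns to the starting edge, which closes the chain.\<close>
  moreover have "?m + ?m - 1 = ?m + (0 + ?m - 1)" using w by simp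
  then have "?x ?m = ?x 0" by (simp only: mod_add_self1)
  ultimately show ?thesis by metis
qed

section \<open>Cut edges as changes of membership around a cycle\<close>

lemma initial_in_witness:
  "\<not> initial_in S w \<Longrightarrow> \<exists>i j. i < j \<and> j < length w \<and> w ! i \<notin> S \<and> w ! j \<in> S"
proof (induction w)
  case (Cons x w)
  show ?case
  proof (cases "x \<in> S")
    case True
    with Cons obtain i j where "i < j" "j < length w" "w ! i \<notin> S" "w ! j \<in> S" by auto
    then show ?thesis by (intro exI[of _ "Suc i"] exI[of _ "Suc j"]) simp
  next
    case False
    with Cons.prems obtain j where "j < length w" "w ! j \<in> S"
      by (auto simp: in_set_conv_nth)
    with False show ?thesis by (intro exI[of _ 0] exI[of _ "Suc j"]) simp
  qed
qed simp

lemma convex_in_witness: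
  "\<not> convex_in S w \<Longrightarrow> \<exists>i j l. i < j \<and> j < l \<and> l < length w \<and> w ! i \<in> S \<and> w ! j \<notin> S \<and> w ! l \<in> S"
proof (induction w)
  case (Cons x w)
  show ?case
  proof (cases "x \<in> S")
    case True
    with Cons.prems obtain i j where "i < j" "j < length w" "w ! i \<notin> S" "w ! j \<in> S"
      using initial_in_witness[of S w] by auto
    with True show ?thesis by (intro exI[of _ 0] exI[of _ "Suc i"] exI[of _ "Suc j"]) simp
  next
    case False
    with Cons obtain i j l where "i < j" "j < l" "l < length w" "w ! i \<in> S" "w ! j \<notin> S" "w ! l \<in> S" by auto
    then show ?thesis by (intro exI[of _ "Suc i"] exI[of _ "Suc j"] exI[of _ "Suc l"]) simp
  qed
qed simp

text \<open>A discrete intermediate value argument: every stretch from a vertex inside a set to one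
  outside, or back, contributes a cut edge.\<close>

lemma change_between:
  fixes p q :: nat
  assumes "p < q" "b p \<noteq> b q"
  obtains t where "p \<le> t" "t < q" "b t \<noteq> b (Suc t)"
proof -
  have "\<exists>t. p \<le> t \<and> t < q \<and> b t \<noteq> b (Suc t)"
  proof (rule ccontr)
    assume *: "\<nexists>t. p \<le> t \<and> t < q \<and> b t \<noteq> b (Suc t)"
    have "b p = b (p + d)" if "p + d \<le> q" for d
      using that * by (induction d) auto
    from this[of "q - p"] assms show False by simp
  qed
  then show ?thesis using that by blast
qed

context
  fixes w :: "'a list"
  assumes w: "distinct w" "3 \<le> length w"
begin

lemma card_cut_cycle_graph:
  "card (cut (cycle_graph w) A) = card {i. i < length w \<and> (w ! i \<in> A \<longleftrightarrow> w ! (Suc i mod length w) \<notin> A)}"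
proof -
  have "cut (cycle_graph w) A = cycle_edge w ` {i. i < length w \<and> (w ! i \<in> A \<longleftrightarrow> w ! (Suc i mod length w) \<notin> A)}"
    unfolding cut_def edges_cycle_graph by (auto simp: cycle_edge_def)
  then show ?thesis
    using inj_on_subset[OF inj_on_cycle_edge[OF w]] by (simp add: card_image subset_eq)
qed

lemma card_cut_cycle_graph_ge:
  assumes "I \<subseteq> {..<length w}" "\<And>i. i \<in> I \<Longrightarrow> (w ! i \<in> A) \<noteq> (w ! (Suc i mod length w) \<in> A)"
  shows "card I \<le> card (cut (cycle_graph w) A)"
  unfolding card_cut_cycle_graph by (rule card_mono) (use assms in \<open>simp, blast\<close>)

lemma cut_cycle_graph_ge_2:
  assumes "x \<in> set w" "x \<in> A" "y \<in> set w" "y \<notin> A"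
  shows "2 \<le> card (cut (cycle_graph w) A)"
proof -
  let ?b = "\<lambda>i. w ! (i mod length w) \<in> A"
  obtain p q where pq: "p < length w" "q < length w" "p < q" "?b p \<noteq> ?b q"
  proof -
    obtain i j where "i < length w" "j < length w" "w ! i = x" "w ! j = y"
      using assms by (auto simp: in_set_conv_nth)
    with assms that[of i j] that[of j i] show thesis
      by (cases i j rule: linorder_cases) auto
  qed
  obtain s where s: "p \<le> s" "s < q" "?b s \<noteq> ?b (Suc s)"
    using change_between[of p q ?b] pq by blast
  \<comment> \<open>The second stretch runs from \<open>q\<close> past the end of the word back to
    \<open>p\<close>; leaving the indices unreduced keeps it increasing.\<close>
  have "?b q \<noteq> ?b (length w + p)" using pq by simp
  then obtain t where t: "q \<le> t" "t < length w + p" "?b t \<noteq> ?b (Suc t)"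
    using change_between[of q "length w + p" ?b] pq by auto
  have "t mod length w \<noteq> s"
  proof (cases "t < length w")
    case True
    with s t show ?thesis by simp
  next
    case False
    then have "t mod length w = t - length w" using t pq by (simp add: le_mod_geq)
    with s t False show ?thesis by simp
  qed
  then have "card {s, t mod length w} = 2" by simp
  moreover have "card {s, t mod length w} \<le> card (cut (cycle_graph w) A)"
  proof (rule card_cut_cycle_graph_ge)
    have "t mod length w < length w" by (rule mod_less_divisor) (use w(2) in linarith)
    then show "{s, t mod length w} \<subseteq> {..<length w}" using s pq by simp
    show "(w ! i \<in> A) \<noteq> (w ! (Suc i mod length w) \<in> A)" if "i \<in> {s, t mod length w}" for i
    proof (cases "i = s")
      case True
      with s pq show ?thesis by simp
    next
      case False
      with that have "i = t mod length w" by simp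
      with t show ?thesis by (simp add: mod_Suc_eq)
    qed
  qed
  ultimately show ?thesis by simp
qed

text \<open>A violation gives positions inside, outside and inside \<open>A\<close>, in this order,
  while position 0 is outside. The four stretches between these positions around the cycle yield
  four cut edges.\<close>

lemma convex_in_if_cut_cycle_graph:
  assumes "card (cut (cycle_graph w) A) < 4" "w ! 0 \<notin> A"
  shows "convex_in A w"
proof (rule ccontr)
  assume "\<not> convex_in A w"
  then obtain i j l where ijl: "i < j" "j < l" "l < length w" "w ! i \<in> A" "w ! j \<notin> A" "w ! l \<in> A"
    using convex_in_witness by blast
  let ?b = "\<lambda>i. w ! (i mod length w) \<in> A"
  have "i \<noteq> 0" using ijl assms(2) by (cases i) auto
  obtain t1 where t1: "t1 < i" "?b t1 \<noteq> ?b (Suc t1)"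
    using change_between[of 0 i ?b] ijl \<open>i \<noteq> 0\<close> assms(2) by auto
  obtain t2 where t2: "i \<le> t2" "t2 < j" "?b t2 \<noteq> ?b (Suc t2)"
    using change_between[of i j ?b] ijl by auto
  obtain t3 where t3: "j \<le> t3" "t3 < l" "?b t3 \<noteq> ?b (Suc t3)"
    using change_between[of j l ?b] ijl by auto
  \<comment> \<open>Here \<open>length w\<close> stands for position 0 after a full turn.\<close>
  obtain t4 where t4: "l \<le> t4" "t4 < length w" "?b t4 \<noteq> ?b (Suc t4)"
    using change_between[of l "length w" ?b] ijl assms(2) by auto
  have "card {t1, t2, t3, t4} \<le> card (cut (cycle_graph w) A)"
    by (rule card_cut_cycle_graph_ge) (use t1 t2 t3 t4 ijl in auto)
  moreover have "card {t1, t2, t3, t4} = 4"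
    using t1 t2 t3 t4 by (simp add: card_insert_if)
  ultimately show False using assms(1) by simp
qed

end

lemma initial_in_map: "initial_in S (map f w) \<longleftrightarrow> initial_in (f -` S) w"
  by (induction w) auto

lemma convex_in_map: "convex_in S (map f w) \<longleftrightarrow> convex_in (f -` S) w"
  by (induction w) (auto simp: initial_in_map)

lemma initial_in_cong: "S \<inter> set w = T \<inter> set w \<Longrightarrow> initial_in S w \<longleftrightarrow> initial_in T w"
proof (induction w)
  case (Cons a w)
  then have "S \<inter> set w = T \<inter> set w" "a \<in> S \<longleftrightarrow> a \<in> T" by (auto simp: set_eq_iff)
  with Cons.IH show ?case by simp
qed simp

lemma convex_in_cong: "S \<inter> set w = T \<inter> set w \<Longrightarrow> convex_in S w \<longleftrightarrow> convex_in T w"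
proof (induction w)
  case (Cons a w)
  then have "S \<inter> set w = T \<inter> set w" "a \<in> S \<longleftrightarrow> a \<in> T" by (auto simp: set_eq_iff)
  with Cons.IH initial_in_cong show ?case by auto
qed simp

lemma cut_complement: "simple_graph G \<Longrightarrow> cut G (verts G - W) = cut G W"
  by (auto simp: cut_def simple_graph_def)

text \<open>Being 2-regular, each circuit through \<open>s\<close> leaves \<open>v\<close> along
  exactly one of \<open>e\<close> and \<open>f\<close>. As \<open>R\<close> covers both, each has
  room for only one further circuit, so the two circuits through \<open>s\<close> go different
  ways.\<close>

lemma circuit_double_cover_at_vertex:
  assumes cdc: "circuit_double_cover S G" and R: "R \<in> S" "e \<in> edges R" "f \<in> edges R" "s \<notin> edges R"
    and v: "{e \<in> edges G. v \<in> e} = {e, f, s}" and ne: "e \<noteq> f" "e \<noteq> s" "f \<noteq> s"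
  obtains C D where "C \<noteq> D" "{X \<in> S. s \<in> edges X} = {C, D}"
    "{X \<in> S. e \<in> edges X} = {R, C}" "{X \<in> S. f \<in> edges X} = {R, D}"
proof -
  have two: "card {X \<in> S. s \<in> edges X} = 2" "card {X \<in> S. e \<in> edges X} = 2" "card {X \<in> S. f \<in> edges X} = 2"
    using cdc v by (auto simp: circuit_double_cover_def)
  have one: "e \<in> edges X \<longleftrightarrow> f \<notin> edges X" if X: "X \<in> S" "s \<in> edges X" for X
  proof -
    have X': "simple_graph X" "\<forall>x\<in>verts X. degree X x = 2" "edges X \<subseteq> edges G"
      using cdc X by (auto simp: circuit_double_cover_def circuit_of_def circuit_def regular_def subgraph_def)
    have "v \<in> s" using v by auto
    then have "v \<in> verts X" using X' X(2) by (auto simp: simple_graph_def)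
    with X'(2) have "card {e \<in> edges X. v \<in> e} = 2" by (simp add: degree_def)
    moreover have "{e \<in> edges X. v \<in> e} = {e, f, s} \<inter> edges X"
      using v X'(3) by auto
    ultimately show ?thesis
      using X(2) ne by (auto simp: Int_insert_left split: if_splits)
  qed
  obtain A B where AB: "{X \<in> S. s \<in> edges X} = {A, B}" "A \<noteq> B"
    using two(1) by (auto simp: card_2_iff)
  then have AB': "A \<in> S" "s \<in> edges A" "B \<in> S" "s \<in> edges B" by auto
  have AR: "A \<noteq> R" "B \<noteq> R" using AB' R(4) by auto
  \<comment> \<open>An edge \<open>g\<close> of \<open>R\<close> lies on just one other circuit of
    \<open>S\<close>; once \<open>C\<close> is known to be that circuit, any third one
    \<open>D\<close> misses \<open>g\<close>.\<close>
  have pair: "{X \<in> S. g \<in> edges X} = {R, C}" "D \<in> S \<Longrightarrow> D \<noteq> R \<Longrightarrow> D \<noteq> C \<Longrightarrow> g \<notin> edges D"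
    if "card {X \<in> S. g \<in> edges X} = 2" "C \<in> S" "g \<in> edges C" "g \<in> edges R" "C \<noteq> R" for g C D
  proof -
    have "{R, C} = {X \<in> S. g \<in> edges X}"
      by (rule card_subset_eq) (use that R in \<open>auto intro: card_ge_0_finite\<close>)
    then show "{X \<in> S. g \<in> edges X} = {R, C}" "D \<in> S \<Longrightarrow> D \<noteq> R \<Longrightarrow> D \<noteq> C \<Longrightarrow> g \<notin> edges D"
      by auto
  qed
  show thesis
  proof (cases "e \<in> edges A")
    case True
    then have "e \<notin> edges B" using pair(2)[OF two(2) AB'(1) True R(2) AR(1)] AB'(3) AR(2) AB(2) by blast
    then have "f \<in> edges B" using one AB' by blast
    with True show thesis using that[OF AB(2,1)] pair(1) two AB' AR R(2,3) by blast
  next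
    case False
    then have "f \<in> edges A" using one AB' by blast
    then have "f \<notin> edges B" using pair(2)[OF two(3) AB'(1) _ R(3) AR(1)] AB'(3) AR(2) AB(2) by blast
    then have "e \<in> edges B" using one AB' by blast
    moreover have "{X \<in> S. s \<in> edges X} = {B, A}" using AB(1) by auto
    ultimately show thesis
      using that[OF AB(2)[symmetric]] pair(1) two AB' AR R(2,3) \<open>f \<in> edges A\<close> by blast
  qed
qed

section \<open>Permutation graphs\<close>

text \<open>Spoke \<open>a\<close> joins the vertex \<open>a\<close> of the first rim to the vertex \<open>m + a\<close> of the second one.\<close>

locale permutation_graph =
  fixes m :: nat and u w :: "nat list"
  assumes u: "distinct u" "set u = {..<m}" and w: "distinct w" "set w = {..<m}"
    and m: "5 \<le> m"
begin

definition "rim1 = cycle_graph u"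
definition "rim2 = cycle_graph (map ((+) m) w)"
definition "rims = graph_union rim1 rim2"
text \<open>Reduction modulo \<open>m\<close> lets either end name its spoke, so
  \<open>spoke v\<close> is the spoke at \<open>v\<close> on both rims.\<close>

definition "spoke v = {v mod m, m + v mod m}"
definition "G = Graph {..<2 * m} (edges rims \<union> spoke ` {..<m})"

lemma length_u: "length u = m" and length_w: "length w = m"
  using distinct_card[OF u(1)] distinct_card[OF w(1)] u(2) w(2) by auto

lemma w': "distinct (map ((+) m) w)" "set (map ((+) m) w) = {m..<2 * m}" "3 \<le> length (map ((+) m) w)"
proof -
  show "set (map ((+) m) w) = {m..<2 * m}"
    unfolding set_map w(2) lessThan_atLeast0 image_add_atLeastLessThan by (simp add: mult_2)
qed (use w m length_w in \<open>auto simp: distinct_map\<close>)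

lemma u': "3 \<le> length u"
  using length_u m by simp

lemma circuit_rims: "circuit rim1" "circuit rim2"
  unfolding rim1_def rim2_def using circuit_cycle_graph[OF u(1) u'] circuit_cycle_graph[OF w'(1,3)] by simp_all

lemma simple_rims: "simple_graph rim1" "simple_graph rim2"
  and connected_rims: "connected rim1" "connected rim2"
  using circuit_rims by (auto simp: circuit_def two_connected_def)

lemma verts_rims [simp]: "verts rim1 = {..<m}" "verts rim2 = {m..<2 * m}"
  using u w' by (simp_all add: rim1_def rim2_def)

lemma verts_G [simp]: "verts G = {..<2 * m}" and edges_G: "edges G = edges rims \<union> spoke ` {..<m}"
  by (simp_all add: G_def)

lemma edges_rims: "edges rims = edges rim1 \<union> edges rim2" and verts_rims' [simp]: "verts rims = {..<2 * m}"
  by (auto simp: rims_def)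

lemma edge_rim1: "e \<in> edges rim1 \<Longrightarrow> e \<subseteq> {..<m} \<and> e \<noteq> {}"
  and edge_rim2: "e \<in> edges rim2 \<Longrightarrow> e \<subseteq> {m..<2 * m} \<and> e \<noteq> {}"
  using simple_rims by (auto simp: simple_graph_def)

lemma spoke_not_subset: "\<not> spoke v \<subseteq> {..<m}" "\<not> spoke v \<subseteq> {m..<2 * m}"
proof -
  have "v mod m < m" using m by simp
  then show "\<not> spoke v \<subseteq> {..<m}" "\<not> spoke v \<subseteq> {m..<2 * m}" by (auto simp: spoke_def)
qed

lemma mod_m: "v < 2 * m \<Longrightarrow> v mod m = (if v < m then v else v - m)"
  by (simp add: le_mod_geq)

lemma spoke_eqD: "spoke v = spoke v' \<Longrightarrow> v mod m = v' mod m"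
proof -
  have "v mod m < m" "v' mod m < m" using m by simp_all
  then show "spoke v = spoke v' \<Longrightarrow> v mod m = v' mod m"
    unfolding spoke_def doubleton_eq_iff by linarith
qed

lemma spoke_notin: "spoke v \<notin> edges rim1" "spoke v \<notin> edges rim2" "spoke v \<notin> edges rims"
  unfolding edges_rims using spoke_not_subset edge_rim1 edge_rim2 by blast+

lemma spoke_in: "spoke v \<in> edges G"
proof -
  have "spoke v = spoke (v mod m)" "v mod m < m" using m by (simp_all add: spoke_def)
  then show ?thesis unfolding edges_G by blast
qed

lemma mem_spoke: "v < 2 * m \<Longrightarrow> v \<in> spoke v"
  using m by (cases "v < m") (auto simp: spoke_def le_mod_geq)

lemma mem_spoke_eq: "v \<in> spoke a \<Longrightarrow> spoke a = spoke v"
proof -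
  assume "v \<in> spoke a"
  then have "v = a mod m \<or> v = m + a mod m" by (simp add: spoke_def)
  then have "v mod m = a mod m" by (elim disjE) simp_all
  then show ?thesis by (simp add: spoke_def)
qed

lemma simple_rims': "simple_graph rims"
  using simple_rims by (auto simp: simple_graph_def rims_def)

lemma simple_G: "simple_graph G"
proof -
  have "spoke a \<subseteq> {..<2 * m} \<and> card (spoke a) = 2" if "a < m" for a
    using that m by (auto simp: spoke_def)
  then show ?thesis using simple_rims' by (auto simp: simple_graph_def edges_G)
qed

lemma edges_at_rims:
  "v < m \<Longrightarrow> {e \<in> edges rims. v \<in> e} = {e \<in> edges rim1. v \<in> e}"
  "m \<le> v \<Longrightarrow> {e \<in> edges rims. v \<in> e} = {e \<in> edges rim2. v \<in> e}"
proof -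
  have "v \<notin> e" if "e \<in> edges rim2" "v < m" for e
    using edge_rim2[OF that(1)] that(2) by (meson atLeastLessThan_iff leD subsetD)
  then show "v < m \<Longrightarrow> {e \<in> edges rims. v \<in> e} = {e \<in> edges rim1. v \<in> e}"
    unfolding edges_rims by blast
  have "v \<notin> e" if "e \<in> edges rim1" "m \<le> v" for e
    using edge_rim1[OF that(1)] that(2) by (meson lessThan_iff leD subsetD)
  then show "m \<le> v \<Longrightarrow> {e \<in> edges rims. v \<in> e} = {e \<in> edges rim2. v \<in> e}"
    unfolding edges_rims by blast
qed

lemma degree_rims: "v < 2 * m \<Longrightarrow> degree rims v = 2"
proof -
  assume v: "v < 2 * m"
  have d: "x < m \<Longrightarrow> degree rim1 x = 2" "m \<le> x \<Longrightarrow> x < 2 * m \<Longrightarrow> degree rim2 x = 2" for x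
    using circuit_rims unfolding circuit_def regular_def by simp_all
  show ?thesis
  proof (cases "v < m")
    case True
    with d(1)[OF True] show ?thesis by (simp only: degree_def edges_at_rims(1))
  next
    case False
    then have "m \<le> v" by simp
    with d(2)[OF this v] show ?thesis by (simp only: degree_def edges_at_rims(2))
  qed
qed

lemma edges_at_G: "v < 2 * m \<Longrightarrow> {e \<in> edges G. v \<in> e} = insert (spoke v) {e \<in> edges rims. v \<in> e}"
  using mem_spoke[of v] mem_spoke_eq[of v] spoke_in[of v] unfolding edges_G by blast

lemma degree_G: "v < 2 * m \<Longrightarrow> degree G v = 3"
  using degree_rims[of v] spoke_notin(3)[of v] simple_finite_edges[OF simple_rims']
  by (simp only: degree_def edges_at_G) simp

lemma cubic_G: "cubic G"
  using simple_G degree_G by (simp add: cubic_def regular_def)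

lemma subgraph_rims: "subgraph rims G" "subgraph rim1 G" "subgraph rim2 G"
  using simple_rims simple_rims' by (auto simp: subgraph_def edges_G edges_rims)

lemma component_rims: "component C rims \<longleftrightarrow> C = rim1 \<or> C = rim2"
  unfolding rims_def using simple_rims connected_rims by (intro component_graph_union_iff) auto

lemma rims_neq: "rim1 \<noteq> rim2"
proof
  assume "rim1 = rim2"
  then have "{..<m} = {m..<2 * m}" using verts_rims by metis
  moreover have "0 \<in> {..<m}" "0 \<notin> {m..<2 * m}" using m by auto
  ultimately show False by blast
qed

lemma permutation_two_factor_rims: "permutation_two_factor rims G"
proof -
  have "{C. component C rims} = {rim1, rim2}" using component_rims by auto
  then have "card {C. component C rims} = 2" using rims_neq by simp
  moreover have "chordless rim1 G" "chordless rim2 G"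
    using spoke_not_subset edge_rim1 edge_rim2 by (fastforce simp: chordless_def edges_G edges_rims)+
  moreover have "two_factor rims G"
    using subgraph_rims degree_rims by (simp add: two_factor_def regular_def)
  ultimately show ?thesis
    using component_rims circuit_rims by (auto simp: permutation_two_factor_def)
qed

lemma has_disjoint_circuits_G: "has_disjoint_circuits G"
  unfolding has_disjoint_circuits_def
  using circuit_rims subgraph_rims by (intro exI[of _ rim1] exI[of _ rim2]) (auto simp: circuit_of_def)

text \<open>\<open>Q s\<close> is the pair of labels prescribed by the spoke \<open>s\<close>.\<close>

lemma labelling_chain:
  fixes lab :: "nat set \<Rightarrow> 'l" and Q :: "nat set \<Rightarrow> 'l set"
  assumes "\<And>v e f. v < 2 * m \<Longrightarrow> e \<in> edges rims \<Longrightarrow> f \<in> edges rims \<Longrightarrow> e \<noteq> f \<Longrightarrow> v \<in> e \<Longrightarrow> v \<in> f \<Longrightarrow>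
    lab e \<noteq> lab f \<and> Q (spoke v) = {lab e, lab f}"
  obtains P :: "nat \<Rightarrow> 'l set" and a b where "chain P u a a" "chain P w b b"
proof -
  have "\<exists>a. chain (Q \<circ> spoke) u a a"
  proof (rule cycle_graph_labelling_chain[OF u(1) u'])
    fix v e f assume "v \<in> e" "v \<in> f" "e \<in> edges (cycle_graph u)" "f \<in> edges (cycle_graph u)" "e \<noteq> f"
    then show "lab e \<noteq> lab f \<and> (Q \<circ> spoke) v = {lab e, lab f}"
      using assms[of v e f] edge_rim1[of e] by (force simp: edges_rims rim1_def)
  qed
  moreover have "\<exists>b. chain (Q \<circ> spoke) (map ((+) m) w) b b"
  proof (rule cycle_graph_labelling_chain[OF w'(1,3)])
    fix v e f assume "v \<in> e" "v \<in> f" "e \<in> edges (cycle_graph (map ((+) m) w))" "f \<in> edges (cycle_graph (map ((+) m) w))" "e \<noteq> f"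
    then show "lab e \<noteq> lab f \<and> (Q \<circ> spoke) v = {lab e, lab f}"
      using assms[of v e f] edge_rim2[of e] by (force simp: edges_rims rim2_def)
  qed
  \<comment> \<open>Both ends of a spoke name the same spoke, so one function \<open>P\<close>
    serves the two rims.\<close>
  moreover have "Q \<circ> spoke \<circ> (+) m = Q \<circ> spoke"
    by (auto simp: spoke_def)
  ultimately show thesis using that unfolding chain_map by metis
qed

lemma edge_colorable_3_chain:
  assumes "edge_colorable 3 G"
  obtains P :: "nat \<Rightarrow> nat set" and a b where "chain P u a a" "chain P w b b"
proof -
  obtain c :: "nat set \<Rightarrow> nat" where "\<forall>e\<in>edges G. c e < 3"
    "\<forall>e\<in>edges G. \<forall>f\<in>edges G. e \<noteq> f \<and> e \<inter> f \<noteq> {} \<longrightarrow> c e \<noteq> c f"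
    using assms unfolding edge_colorable_def by (elim exE conjE)
  then have c: "\<And>e. e \<in> edges G \<Longrightarrow> c e < 3"
    "\<And>e f. e \<in> edges G \<Longrightarrow> f \<in> edges G \<Longrightarrow> e \<noteq> f \<Longrightarrow> e \<inter> f \<noteq> {} \<Longrightarrow> c e \<noteq> c f"
    by blast+
  show thesis
  \<comment> \<open>A spoke prescribes the two colours other than its own; the three edges at a
    vertex use all three colours.\<close>
  proof (rule labelling_chain[of c "\<lambda>s. {..<3} - {c s}"])
    fix v e f assume v: "v < 2 * m" and e: "e \<in> edges rims" "f \<in> edges rims" "e \<noteq> f" "v \<in> e" "v \<in> f"
    have "e \<noteq> spoke v" "f \<noteq> spoke v" using spoke_notin(3) e by auto
    moreover have G: "e \<in> edges G" "f \<in> edges G" "spoke v \<in> edges G" using e spoke_in by (auto simp: edges_G)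
    moreover have "e \<inter> f \<noteq> {}" "e \<inter> spoke v \<noteq> {}" "f \<inter> spoke v \<noteq> {}"
      using e mem_spoke[OF v] by auto
    ultimately have "c e \<noteq> c f" "c e \<noteq> c (spoke v)" "c f \<noteq> c (spoke v)"
      using c(2) e(3) by blast+
    moreover have "c e < 3" "c f < 3" "c (spoke v) < 3" using c(1) G by blast+
    ultimately show "c e \<noteq> c f \<and> {..<3} - {c (spoke v)} = {c e, c f}"
      by auto
  qed (rule that)
qed

lemma circuit_double_cover_chain:
  assumes "circuit_double_cover S G" "contained_in rims S"
  obtains P :: "nat \<Rightarrow> nat graph set" and a b where "chain P u a a" "chain P w b b"
proof -
  have rims: "rim1 \<in> S" "rim2 \<in> S"
    using assms(2) component_rims by (auto simp: contained_in_def)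
  \<comment> \<open>The circuit that covers a rim edge together with its rim. Excluding both rims
    avoids asking which of them contains the edge.\<close>
  define lab where "lab e = (THE C. C \<in> S \<and> e \<in> edges C \<and> C \<noteq> rim1 \<and> C \<noteq> rim2)" for e
  show thesis
  proof (rule labelling_chain[of lab "\<lambda>s. {C \<in> S. s \<in> edges C}"])
    fix v e f assume v: "v < 2 * m" and e: "e \<in> edges rims" "f \<in> edges rims" "e \<noteq> f" "v \<in> e" "v \<in> f"
    obtain R where R: "R = rim1 \<or> R = rim2" "e \<in> edges R" "f \<in> edges R"
      using e edges_at_rims[of v] by (cases "v < m") auto
    have "{e, f} = {e \<in> edges rims. v \<in> e}"
      using e degree_rims[OF v] by (intro card_subset_eq) (auto simp: degree_def intro: card_ge_0_finite)
    then have at: "{e \<in> edges G. v \<in> e} = {e, f, spoke v}"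
      using edges_at_G[OF v] by auto
    have s: "spoke v \<notin> edges R" "e \<noteq> spoke v" "f \<noteq> spoke v"
      using spoke_notin R(1) e by auto
    have "R \<in> S" using R(1) rims by auto
    obtain C D where CD: "C \<noteq> D" "{X \<in> S. spoke v \<in> edges X} = {C, D}"
      "{X \<in> S. e \<in> edges X} = {R, C}" "{X \<in> S. f \<in> edges X} = {R, D}"
      by (rule circuit_double_cover_at_vertex[OF assms(1) \<open>R \<in> S\<close> R(2,3) s(1) at e(3) s(2,3)])
    have not_rim: "C \<noteq> rim1" "C \<noteq> rim2" "D \<noteq> rim1" "D \<noteq> rim2"
      using CD(2) spoke_notin by blast+
    have "lab e = C" "lab f = D"
      unfolding lab_def by (rule the_equality; use CD(3,4) R(1) not_rim in blast)+
    with CD show "lab e \<noteq> lab f \<and> {C \<in> S. spoke v \<in> edges C} = {lab e, lab f}" by simp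
  qed (rule that)
qed

section \<open>Edge cuts of permutation graphs\<close>

lemma finite_cut: "finite (cut G W)"
  using simple_finite_edges[OF simple_G] by (simp add: cut_def)

text \<open>All spokes at \<open>W\<close> leave \<open>W\<close>, which gives at least three cut
  edges, and the rim adds two more. If \<open>W\<close> is the whole rim, its \<open>m\<close>
  spokes suffice.\<close>

lemma cut_ge_5_in_rim:
  assumes x: "x = u \<or> x = map ((+) m) w" and W: "W \<subseteq> set x" "3 \<le> card W"
  shows "5 \<le> card (cut G W)"
proof -
  have d: "distinct x" "3 \<le> length x" "length x = m"
    using x u u' w w' length_u length_w by auto
  have side: "set x = {..<m} \<or> set x = {m..<2 * m}" and E: "edges (cycle_graph x) \<subseteq> edges rims"
    using x u w' by (auto simp: edges_rims rim1_def rim2_def)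
  have "inj_on spoke W"
  proof (rule inj_onI)
    fix v v' assume v: "v \<in> W" "v' \<in> W" "spoke v = spoke v'"
    then have "v \<in> set x" "v' \<in> set x" using W(1) by auto
    from side show "v = v'"
    proof
      assume "set x = {..<m}"
      then have "v < m" "v' < m" using \<open>v \<in> set x\<close> \<open>v' \<in> set x\<close> by auto
      then show ?thesis using spoke_eqD[OF v(3)] by simp
    next
      assume "set x = {m..<2 * m}"
      then have "m \<le> v" "v < 2 * m" "m \<le> v'" "v' < 2 * m" using \<open>v \<in> set x\<close> \<open>v' \<in> set x\<close> by auto
      then show ?thesis using spoke_eqD[OF v(3)] mod_m[of v] mod_m[of v'] by simp
    qed
  qed
  then have sp: "card (spoke ` W) = card W" by (rule card_image)
  have "spoke v \<in> cut G W" if "v \<in> W" for v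
  proof -
    have "v \<in> set x" using that W(1) by blast
    then have "v \<in> {..<m} \<union> {m..<2 * m}" using side by blast
    then have "v < 2 * m" by auto
    moreover have "\<not> spoke v \<subseteq> W" using side W(1) spoke_not_subset[of v] by blast
    ultimately show ?thesis using mem_spoke[of v] spoke_in that by (auto simp: cut_def)
  qed
  then have sub: "cut (cycle_graph x) W \<union> spoke ` W \<subseteq> cut G W"
    using E by (auto simp: cut_def edges_G)
  have disj: "cut (cycle_graph x) W \<inter> spoke ` W = {}"
    using E spoke_notin(3) by (auto simp: cut_def)
  have fin: "finite (cut (cycle_graph x) W)" "finite (spoke ` W)"
    using sub finite_cut[of W] by (auto intro: finite_subset)
  have le: "card (cut (cycle_graph x) W) + card W \<le> card (cut G W)"
    using card_mono[OF finite_cut sub] card_Un_disjoint[OF fin disj] sp by simp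
  show ?thesis
  proof (cases "W = set x")
    case True
    with le d m show ?thesis by (simp add: distinct_card)
  next
    case False
    then obtain y where "y \<in> set x" "y \<notin> W" using W(1) by auto
    moreover obtain z where "z \<in> W" using W(2) by fastforce
    ultimately have "2 \<le> card (cut (cycle_graph x) W)"
      using W(1) cut_cycle_graph_ge_2[OF d(1,2), of z W y] by auto
    with le W(2) show ?thesis by simp
  qed
qed

end

text \<open>The analogue of a simple permutation for two cyclic orders, cut open at a common first
  spoke: only trivial sets are intervals of both. Arcs through that spoke are treated by passing to
  the complement.\<close>

locale simple_permutation_graph = permutation_graph +
  assumes hd_eq: "hd u = hd w"
    and simple: "\<And>S. convex_in S (tl u) \<Longrightarrow> convex_in S (tl w) \<Longrightarrow>
      set (tl w) \<subseteq> S \<or> (\<exists>c. S \<inter> set (tl w) \<subseteq> {c})"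
begin

text \<open>Each rim contributes at least two cut edges. With fewer than five in all, no spoke is
  cut and \<open>W\<close> meets each rim in an arc, with the same spokes on both. Simplicity then
  leaves at most one spoke inside \<open>W\<close> or at most one outside, that is, too few vertices
  on one side.\<close>

lemma cut_ge_5_avoiding:
  assumes W: "3 \<le> card W" "3 \<le> card ({..<2 * m} - W)" "W \<subseteq> {..<2 * m}" "hd u \<notin> W"
    and proper: "\<not> W \<subseteq> {m..<2 * m}" "\<not> W \<subseteq> {..<m}" "\<not> {..<m} \<subseteq> W" "\<not> {m..<2 * m} \<subseteq> W"
  shows "5 \<le> card (cut G W)"
proof (rule ccontr)
  assume "\<not> 5 \<le> card (cut G W)"
  then have small: "card (cut G W) < 5" by simp
  let ?w = "map ((+) m) w" and ?T = "{s \<in> spoke ` {..<m}. s \<inter> W \<noteq> {} \<and> \<not> s \<subseteq> W}"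
  have dec: "cut G W = cut rim1 W \<union> cut rim2 W \<union> ?T"
    by (auto simp: cut_def edges_G edges_rims)
  have fin: "finite (cut rim1 W)" "finite (cut rim2 W)" "finite ?T"
    using finite_cut[of W] unfolding dec by auto
  have "cut rim1 W \<inter> cut rim2 W = {}"
    using edge_rim1 edge_rim2 by (fastforce simp: cut_def)
  moreover have "(cut rim1 W \<union> cut rim2 W) \<inter> ?T = {}"
    using spoke_notin by (auto simp: cut_def)
  ultimately have card: "card (cut G W) = card (cut rim1 W) + card (cut rim2 W) + card ?T"
    unfolding dec using fin by (simp add: card_Un_disjoint)
  obtain x1 y1 where "x1 \<in> set u" "x1 \<in> W" "y1 \<in> set u" "y1 \<notin> W"
  proof -
    have "\<exists>x. x < m \<and> x \<in> W" "\<exists>x. x < m \<and> x \<notin> W"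
      using proper(1,3) W(3) by (force simp: not_le)+
    then show thesis using that u(2) by blast
  qed
  then have c1: "2 \<le> card (cut rim1 W)"
    unfolding rim1_def by (rule cut_cycle_graph_ge_2[OF u(1) u'])
  obtain x2 y2 where "x2 \<in> set ?w" "x2 \<in> W" "y2 \<in> set ?w" "y2 \<notin> W"
  proof -
    have "\<exists>x. m \<le> x \<and> x < 2 * m \<and> x \<in> W" "\<exists>x. m \<le> x \<and> x < 2 * m \<and> x \<notin> W"
      using proper(2,4) W(3) by (force simp: not_less)+
    then show thesis using that w'(2) by auto
  qed
  then have c2: "2 \<le> card (cut rim2 W)"
    unfolding rim2_def by (rule cut_cycle_graph_ge_2[OF w'(1,3)])
  have "card ?T = 0" using card small c1 c2 by linarith
  then have "?T = {}" using fin(3) by simp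
  then have same: "a \<in> W \<longleftrightarrow> m + a \<in> W" if "a < m" for a
  proof -
    have "spoke a \<inter> W = {} \<or> spoke a \<subseteq> W" using \<open>?T = {}\<close> that by blast
    then show ?thesis using that by (auto simp: spoke_def)
  qed
  \<comment> \<open>\<open>?S\<close> consists of the spokes with their second end in
    \<open>W\<close>; by \<open>same\<close> they are exactly those contained in
    \<open>W\<close>.\<close>
  let ?S = "(+) m -` W" and ?z = "hd u"
  have u_eq: "u = ?z # tl u" and w_eq: "w = ?z # tl w"
  proof -
    have "u \<noteq> []" "w \<noteq> []" using m length_u length_w by auto
    then show "u = ?z # tl u" "w = ?z # tl w" using hd_eq by (metis list.collapse)+
  qed
  have "?z \<in> set u" using u_eq by (metis list.set_intros(1))
  then have z: "?z < m" "m + ?z \<notin> W" using u(2) W(4) same by auto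
  have nth: "u ! 0 = ?z" "map ((+) m) w ! 0 = m + ?z"
    using u_eq w_eq by (metis nth_Cons_0, metis nth_Cons_0 list.simps(9))
  have "card (cut rim1 W) < 4" "card (cut rim2 W) < 4" using card small c1 c2 by linarith+
  then have conv: "convex_in W u" "convex_in W ?w"
    unfolding rim1_def rim2_def using z(2) W(4) nth
    by (auto intro: convex_in_if_cut_cycle_graph[OF u(1) u'] convex_in_if_cut_cycle_graph[OF w'(1,3)])
  have "convex_in W (tl u)" using conv(1) W(4) u_eq by (metis convex_in.simps(2))
  moreover have "W \<inter> set (tl u) = ?S \<inter> set (tl u)"
  proof -
    have "set (tl u) \<subseteq> {..<m}" using u(2) u_eq by (metis set_subset_Cons)
    then show ?thesis using same by auto
  qed
  ultimately have 1: "convex_in ?S (tl u)" by (metis convex_in_cong)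
  have "convex_in ?S w" using conv(2) by (simp only: convex_in_map)
  then have "convex_in ?S (tl w)" using z(2) w_eq by (metis convex_in.simps(2) vimageD)
  from simple[OF 1 this] show False
  proof
    \<comment> \<open>Only the spoke \<open>?z\<close> remains outside \<open>W\<close>, so its
      complement has at most two vertices.\<close>
    assume S: "set (tl w) \<subseteq> ?S"
    have "v = ?z \<or> v = m + ?z" if "v < 2 * m" "v \<notin> W" for v
    proof -
      have "v mod m < m" using m by simp
      then have "v mod m \<in> set w" using w(2) by auto
      moreover have "v mod m \<notin> ?S"
        using that m same[of v] by (cases "v < m") (auto simp: le_mod_geq)
      ultimately have "v mod m = ?z" using S w_eq by (metis set_ConsD subsetD)
      then show ?thesis using that m by (cases "v < m") (auto simp: le_mod_geq)
    qed
    then have "{..<2 * m} - W \<subseteq> {?z, m + ?z}" by auto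
    then have "card ({..<2 * m} - W) \<le> card {?z, m + ?z}" by (intro card_mono) auto
    with W(2) m show False by (simp add: card_insert_if split: if_splits)
  next
    assume "\<exists>c. ?S \<inter> set (tl w) \<subseteq> {c}"
    then obtain c where S: "?S \<inter> set (tl w) \<subseteq> {c}" by blast
    have "v = c \<or> v = m + c" if "v \<in> W" for v
    proof -
      have "v mod m < m" using m by simp
      then have "v mod m \<in> set w" using w(2) by auto
      moreover have "v mod m \<in> ?S"
        using that W(3) m same[of v] by (cases "v < m") (auto simp: le_mod_geq)
      ultimately have "v mod m = c" using S w_eq z(2) by (metis IntI set_ConsD singletonD subsetD vimageD)
      then show ?thesis using that W(3) m by (cases "v < m") (auto simp: le_mod_geq)
    qed
    then have "W \<subseteq> {c, m + c}" by auto
    then have "card W \<le> card {c, m + c}" by (intro card_mono) auto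
    with W(1) m show False by (simp add: card_insert_if split: if_splits)
  qed
qed

text \<open>A set and its complement have the same cut. If neither lies in a rim, both meet both
  rims, and one of them avoids \<open>hd u\<close>.\<close>

lemma cut_ge_5:
  assumes W: "W \<subseteq> verts G" "3 \<le> card W" "3 \<le> card (verts G - W)"
  shows "5 \<le> card (cut G W)"
proof -
  have in_rim: "5 \<le> card (cut G A)" if "A \<subseteq> {..<m} \<or> A \<subseteq> {m..<2 * m}" "3 \<le> card A" for A
    using that cut_ge_5_in_rim[of u A] cut_ge_5_in_rim[of "map ((+) m) w" A] unfolding w'(2) u(2) by auto
  let ?W = "verts G - W"
  have c: "cut G ?W = cut G W" using cut_complement[OF simple_G] .
  consider "W \<subseteq> {..<m} \<or> W \<subseteq> {m..<2 * m}" | "?W \<subseteq> {..<m} \<or> ?W \<subseteq> {m..<2 * m}"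
    | "\<not> W \<subseteq> {m..<2 * m}" "\<not> W \<subseteq> {..<m}" "\<not> ?W \<subseteq> {m..<2 * m}" "\<not> ?W \<subseteq> {..<m}" by blast
  then show ?thesis
  proof cases
    case 1
    then show ?thesis using in_rim W(2) by blast
  next
    case 2
    then show ?thesis using in_rim W(3) c by metis
  next
    case 3
    have split: "{..<2 * m} = {..<m} \<union> {m..<2 * m}" and disjoint: "{..<m} \<inter> {m..<2 * m} = {}" by auto
    have n: "\<not> {..<m} \<subseteq> W" "\<not> {m..<2 * m} \<subseteq> W" "\<not> {..<m} \<subseteq> ?W" "\<not> {m..<2 * m} \<subseteq> ?W"
      using 3 W(1) disjoint unfolding verts_G split by blast+
    show ?thesis
    proof (cases "hd u \<in> W")
      case True
      have "verts G - ?W = W" using W(1) by blast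
      then have "5 \<le> card (cut G ?W)"
        using True W 3 n by (intro cut_ge_5_avoiding) (simp_all del: verts_G add: verts_G[symmetric])
      then show ?thesis using c by simp
    next
      case False
      then show ?thesis using W 3 n by (intro cut_ge_5_avoiding) simp_all
    qed
  qed
qed

lemma cyclically_5_edge_connected_G: "cyclically_edge_connected 5 G"
  by (rule cyclically_edge_connectedI[OF simple_G has_disjoint_circuits_G cut_ge_5])

lemma girth_G: "girth G \<ge> 5"
  by (rule girth_ge5I[OF cubic_G _ cut_ge_5]) (use m in auto)

end

theorem theorem1p1:
  fixes n :: nat
  shows "\<exists>G :: nat graph.
    permutation_snark G \<and> cyclically_edge_connected 5 G \<and> order G = 10 + 24 * n \<and>
    (\<exists>F. permutation_two_factor F G \<and>
      (\<forall>S. circuit_double_cover S G \<longrightarrow> \<not> contained_in F S))"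
proof -
  \<comment> \<open>There are \<open>5 + 12 * n\<close> spokes and twice as many vertices; spoke
    \<open>1\<close> heads both words and is where the cyclic orders are cut open.\<close>
  let ?m = "5 + 12 * n" and ?u = "1 # 0 # outer n" and ?w = "1 # inner n"
  interpret simple_permutation_graph ?m ?u ?w
  proof
    show "distinct ?u" "distinct ?w"
      using distinct_outer distinct_inner by (auto simp: set_outer set_inner)
    show "set ?u = {..<?m}" "set ?w = {..<?m}"
      by (auto simp: set_outer set_inner)
    show "5 \<le> ?m" "hd ?u = hd ?w" by simp_all
    show "set (tl ?w) \<subseteq> S \<or> (\<exists>c. S \<inter> set (tl ?w) \<subseteq> {c})"
      if "convex_in S (tl ?u)" "convex_in S (tl ?w)" for S
      using convex_in_outer_inner[of S n] that by (simp only: list.sel)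
  qed
  have "cyclically_edge_connected 4 G"
    using cyclically_5_edge_connected_G order_trans[of "enat 4" "enat 5"]
    by (simp add: cyclically_edge_connected_def)
  moreover have "\<not> edge_colorable 3 G"
    using edge_colorable_3_chain no_closed_chain_outer_inner by metis
  ultimately have "permutation_snark G"
    using cubic_G girth_G permutation_two_factor_rims
    by (auto simp: permutation_snark_def cycle_permutation_graph_def snark_def)
  moreover have "order G = 10 + 24 * n"
    unfolding order_def verts_G by simp
  moreover have "\<not> contained_in rims S" if "circuit_double_cover S G" for S
    using circuit_double_cover_chain[OF that] no_closed_chain_outer_inner by metis
  ultimately show ?thesis
    using cyclically_5_edge_connected_G permutation_two_factor_rims by blast
qed

end
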